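(* There exist real numbers $a_*\in\left(\frac{5204}{10000},\frac{5244}{10000}\right)$ and $t_*\in\left(\frac{3966}{10000},\frac{3991}{10000}\right)$ such that the solution $(r(t),\theta(t),\alpha(t))$ of the system of ordinary differential equations \[ \dot r = \cos\alpha,\qquad \dot\theta = \frac{\sin\alpha}{\sin r},\qquad \dot\alpha = \frac{2\cot(2\theta)}{\sin r}\,\cos\alpha - 3\cot r\,\sin\alpha - 3, \] with initial conditions $r(0)=\frac{\pi}{2}$, $\theta(0)=a_*$, $\alpha(0)=\pi$, is defined for all $t\in\left[0,\frac{3991}{10000}\right]$ and satisfies \[ \alpha(t_* )=\frac{\pi}{2},\qquad \theta(t_* )=\frac{\pi}{4}. \]
   Context: Here $r,\theta,\alpha$ are real-valued functions of the real variable $t$, and a dot denotes $d/dt$. The right-hand side of the system is considered on the open set where $\sin r\neq 0$ and $\sin(2\theta)\neq 0$. *)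

theory Defs
  imports "HOL-Analysis.Analysis"
begin

text \<open>
  Solutions on a set \<open>I\<close> of times are functions satisfying the equations for the derivative
  within \<open>I\<close>, which is one-sided at the endpoints when \<open>I\<close> is a closed interval. The
  inequations keep the curve in the open set where the right-hand side is considered; without
  them, the convention \<open>x / 0 = 0\<close> would give the right-hand side a value everywhere.
\<close>

definition solves_system ::
    "(real \<Rightarrow> real) \<Rightarrow> (real \<Rightarrow> real) \<Rightarrow> (real \<Rightarrow> real) \<Rightarrow> real set \<Rightarrow> bool" where
  "solves_system r \<theta> \<alpha> I \<longleftrightarrow>
     (\<forall>t\<in>I. sin (r t) \<noteq> 0 \<and> sin (2 * \<theta> t) \<noteq> 0 \<and>
        (r has_real_derivative cos (\<alpha> t)) (at t within I) \<and>
        (\<theta> has_real_derivative sin (\<alpha> t) / sin (r t)) (at t within I) \<and>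
        (\<alpha> has_real_derivative
           2 * cot (2 * \<theta> t) / sin (r t) * cos (\<alpha> t) - 3 * cot (r t) * sin (\<alpha> t) - 3)
          (at t within I))"

end

theory Submission
  imports Defs
begin

text \<open>
  The problem is a shooting problem: the parameter \<open>a\<close> has to be chosen so that \<open>\<alpha> = pi / 2\<close> and
  \<open>\<theta> = pi / 4\<close> happen at the same time. It loses this character when \<open>\<alpha>\<close>, which decreases, is
  taken as the independent variable. Put \<open>b = \<alpha> - pi / 2\<close>, \<open>\<phi> = pi / 4 - \<theta>\<close>, define \<open>R\<close> by
  \<open>sin (pi / 2 - r) = tanh R\<close>, and let
  \<open>K = 2 sin b tan (2 \<phi>) + 3 cos b tanh R + 3 / cosh R\<close>. Then \<open>db / dt = - K cosh R\<close>, and in terms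
  of \<open>g = 1 / K\<close> the remaining equations are \<open>d\<phi> / db = g cos b\<close>, \<open>dR / db = - g sin b\<close> and
  \<open>dt / db = - g / cosh R\<close>. The initial condition \<open>r = pi / 2\<close> is \<open>R = 0\<close> at \<open>b = pi / 2\<close>, and the
  target is \<open>\<phi> = 0\<close> at \<open>b = 0\<close>. Hence \<open>\<phi>\<close> is the integral of \<open>g cos\<close> from \<open>0\<close> to \<open>b\<close>, \<open>R\<close> is the
  integral of \<open>g sin\<close> from \<open>b\<close> to \<open>pi / 2\<close>, and the whole boundary value problem is the single
  fixed point equation \<open>g = 1 / K\<close> for the function \<open>g\<close>. Every solution provides an
  initial value \<open>a = pi / 4 - \<phi>(pi / 2)\<close> and a hitting time, the integral of \<open>g / cosh R\<close> over
  \<open>[0, pi / 2]\<close>.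

  Near its approximate fixed point \<open>g_app b = 0.2743 - 0.0339 sin\<^sup>2 b\<close> the map \<open>g \<mapsto> 1 / K\<close> is a
  contraction with constant one half in the supremum norm, because
  \<open>K \<ge> 7/2\<close> (lemma \<open>rate_lower\<close>) and \<open>K\<close> changes by at most six times the change of \<open>g\<close> (lemma
  \<open>rate_lipschitz\<close>). The function \<open>g_app\<close> satisfies the equation up to
  \<open>7/40000\<close> (lemma \<open>rate_app_residual\<close>); its integrals are polynomials in \<open>sin b\<close> and \<open>cos b\<close>, so with
  polynomial bounds for \<open>tan\<close>, \<open>tanh\<close> and \<open>1 / cosh\<close> this is a polynomial inequality in \<open>sin\<^sup>2 b\<close>. Banach's theorem then gives a fixed point within
  \<open>7/20000\<close> of \<open>g_app\<close> (lemma \<open>fixpoint_exists\<close>), and this accuracy decides both the range of \<open>a\<close>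
  (lemma \<open>initial_theta\<close>) and the range of the hitting time (lemma \<open>time_0\<close>).

  The solution must also be continued a little beyond the hitting time. The equation is
  invariant under \<open>(b, R, \<phi>) \<mapsto> (- b, R, - \<phi>)\<close>, so a fixed point extended evenly to
  \<open>[- pi / 2, pi / 2]\<close> solves it there, which covers about twice the hitting time.
\<close>

section \<open>Polynomial bounds for elementary functions\<close>

lemma increment_mono:
  fixes F G :: "real \<Rightarrow> real"
  assumes "a \<le> b"
    and F: "\<And>x. a \<le> x \<Longrightarrow> x \<le> b \<Longrightarrow> (F has_real_derivative F' x) (at x)"
    and G: "\<And>x. a \<le> x \<Longrightarrow> x \<le> b \<Longrightarrow> (G has_real_derivative G' x) (at x)"
    and le: "\<And>x. a \<le> x \<Longrightarrow> x \<le> b \<Longrightarrow> F' x \<le> G' x"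
  shows "F b - F a \<le> G b - G a"
proof -
  have "(\<lambda>x. G x - F x) a \<le> (\<lambda>x. G x - F x) b"
  proof (rule DERIV_nonneg_imp_nondecreasing[OF \<open>a \<le> b\<close>])
    fix x assume x: "a \<le> x" "x \<le> b"
    have "((\<lambda>x. G x - F x) has_real_derivative G' x - F' x) (at x)"
      by (intro DERIV_diff F G x)
    then show "\<exists>y. ((\<lambda>x. G x - F x) has_real_derivative y) (at x) \<and> 0 \<le> y"
      using le[OF x] by (intro exI[of _ "G' x - F' x"]) simp
  qed
  then show ?thesis by simp
qed

lemma tanh_has_deriv: "(tanh has_real_derivative 1 - (tanh x)\<^sup>2) (at x)" for x :: real
  using cosh_real_pos[of x] by (auto intro!: derivative_eq_intros)

lemma sech_has_deriv: "((\<lambda>x. 1 / cosh x) has_real_derivative - (tanh x / cosh x)) (at x)" for x :: real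
  using cosh_real_pos[of x] by (auto intro!: derivative_eq_intros simp: tanh_def power2_eq_square)

text \<open>
  Bounds for \<open>tanh\<close> are fed back into \<open>tanh' = 1 - tanh\<^sup>2\<close>, each lower bound giving the next upper
  bound; together with \<open>(1 / cosh)' = - tanh / cosh\<close> they give those for \<open>1 / cosh\<close>.
\<close>

lemma assumes "0 \<le> x" shows tanh_ge_cubic: "x - x ^ 3 / 3 \<le> tanh (x::real)"
  and tanh_le: "tanh x \<le> x"
proof -
  have *: "tanh x \<le> x" if "0 \<le> x" for x :: real
    using increment_mono[OF that, of tanh "\<lambda>x. 1 - (tanh x)\<^sup>2" "\<lambda>x. x" "\<lambda>_. 1"] tanh_has_deriv
    by simp
  then show "tanh x \<le> x" using assms by blast
  have "(\<lambda>x. x - x ^ 3 / 3) x - (\<lambda>x. x - x ^ 3 / 3) 0 \<le> tanh x - tanh 0"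
  proof (rule increment_mono[OF assms])
    fix y :: real assume "0 \<le> y"
    show "((\<lambda>x. x - x ^ 3 / 3) has_real_derivative 1 - y\<^sup>2) (at y)"
      by (auto intro!: derivative_eq_intros)
    show "1 - y\<^sup>2 \<le> 1 - (tanh y)\<^sup>2" using *[OF \<open>0 \<le> y\<close>] \<open>0 \<le> y\<close> by (simp add: power_mono)
  qed (rule tanh_has_deriv)
  then show "x - x ^ 3 / 3 \<le> tanh x" by simp
qed

lemma tanh_le_quintic: assumes "0 \<le> x" "x \<le> 1" shows "tanh (x::real) \<le> x - x ^ 3 / 3 + 2 * x ^ 5 / 15"
proof -
  have "tanh x - tanh 0 \<le> (\<lambda>x. x - x ^ 3 / 3 + 2 * x ^ 5 / 15) x - (\<lambda>x. x - x ^ 3 / 3 + 2 * x ^ 5 / 15) 0"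
  proof (rule increment_mono[OF assms(1)])
    fix y :: real assume y: "0 \<le> y" "y \<le> x"
    show "((\<lambda>x. x - x ^ 3 / 3 + 2 * x ^ 5 / 15) has_real_derivative 1 - y\<^sup>2 + 2 * y ^ 4 / 3) (at y)"
      by (auto intro!: derivative_eq_intros)
    have "y ^ 3 \<le> y" using y assms power_decreasing[of 1 3 y] by simp
    then have "(y - y ^ 3 / 3)\<^sup>2 \<le> (tanh y)\<^sup>2"
      using tanh_ge_cubic[of y] y by (intro power_mono) auto
    moreover have "(y - y ^ 3 / 3)\<^sup>2 = y\<^sup>2 - 2 * y ^ 4 / 3 + (y ^ 3)\<^sup>2 / 9"
      by (simp add: field_simps power2_eq_square eval_nat_numeral)
    ultimately show "1 - (tanh y)\<^sup>2 \<le> 1 - y\<^sup>2 + 2 * y ^ 4 / 3" using zero_le_power2[of "y ^ 3"] by linarith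
  qed (rule tanh_has_deriv)
  then show ?thesis by simp
qed

lemma sech_le_one: "1 / cosh x \<le> (1::real)"
  using cosh_real_ge_1[of x] by simp

lemma sech_ge_quadratic: assumes "0 \<le> x" shows "1 - x\<^sup>2 / 2 \<le> 1 / cosh (x::real)"
proof -
  have "(\<lambda>x. 1 - x\<^sup>2 / 2) x - (\<lambda>x. 1 - x\<^sup>2 / 2) 0 \<le> 1 / cosh x - 1 / cosh (0::real)"
  proof (rule increment_mono[OF assms])
    fix y :: real assume "0 \<le> y"
    show "((\<lambda>x. 1 - x\<^sup>2 / 2) has_real_derivative - y) (at y)"
      by (auto intro!: derivative_eq_intros)
    have "tanh y * (1 / cosh y) \<le> y * 1"
      using tanh_le[OF \<open>0 \<le> y\<close>] sech_le_one[of y] \<open>0 \<le> y\<close> by (intro mult_mono) auto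
    then show "- y \<le> - (tanh y / cosh y)" by simp
  qed (rule sech_has_deriv)
  then show ?thesis by simp
qed

lemma sech_le_quartic: assumes "0 \<le> x" "x \<le> 1"
  shows "1 / cosh (x::real) \<le> 1 - x\<^sup>2 / 2 + 5 * x ^ 4 / 24"
proof -
  have "1 / cosh x - 1 / cosh (0::real) \<le> (\<lambda>x. 1 - x\<^sup>2 / 2 + 5 * x ^ 4 / 24) x - (\<lambda>x. 1 - x\<^sup>2 / 2 + 5 * x ^ 4 / 24) 0"
  proof (rule increment_mono[OF assms(1)])
    fix y :: real assume y: "0 \<le> y" "y \<le> x"
    show "((\<lambda>x. 1 - x\<^sup>2 / 2 + 5 * x ^ 4 / 24) has_real_derivative - y + 5 * y ^ 3 / 6) (at y)"
      by (auto intro!: derivative_eq_intros)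
    have p: "y\<^sup>2 \<le> 1" "y ^ 3 \<le> y" "0 \<le> y ^ 5"
      using y assms power_decreasing[of 1 3 y] power_le_one[of y 2] by simp_all
    have "(y - y ^ 3 / 3) * (1 - y\<^sup>2 / 2) \<le> tanh y * (1 / cosh y)"
      using tanh_ge_cubic[of y] sech_ge_quadratic[of y] p y by (intro mult_mono) auto
    moreover have "(y - y ^ 3 / 3) * (1 - y\<^sup>2 / 2) = y - 5 * y ^ 3 / 6 + y ^ 5 / 6"
      by (simp add: field_simps eval_nat_numeral)
    ultimately have "y - 5 * y ^ 3 / 6 \<le> tanh y * (1 / cosh y)" using p by linarith
    then show "- (tanh y / cosh y) \<le> - y + 5 * y ^ 3 / 6" by simp
  qed (rule sech_has_deriv)
  then show ?thesis by simp
qed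

lemma sech_ge_quartic: assumes "0 \<le> x" "x \<le> 28/100"
  shows "1 - x\<^sup>2 / 2 + x ^ 4 / 5 \<le> 1 / cosh (x::real)"
proof -
  have "(\<lambda>x. 1 - x\<^sup>2 / 2 + 5 * x ^ 4 / 24 - 61 * x ^ 6 / 720) x - (\<lambda>x. 1 - x\<^sup>2 / 2 + 5 * x ^ 4 / 24 - 61 * x ^ 6 / 720) 0
     \<le> 1 / cosh x - 1 / cosh (0::real)"
  proof (rule increment_mono[OF assms(1)])
    fix y :: real assume y: "0 \<le> y" "y \<le> x"
    show "((\<lambda>x. 1 - x\<^sup>2 / 2 + 5 * x ^ 4 / 24 - 61 * x ^ 6 / 720) has_real_derivative
        - y + 5 * y ^ 3 / 6 - 61 * y ^ 5 / 120) (at y)"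
      by (auto intro!: derivative_eq_intros)
    have p: "y\<^sup>2 \<le> 1"
      using y assms power_le_one[of y 2] by simp
    have "tanh y * (1 / cosh y) \<le> (y - y ^ 3 / 3 + 2 * y ^ 5 / 15) * (1 - y\<^sup>2 / 2 + 5 * y ^ 4 / 24)"
      using tanh_le_quintic[of y] sech_le_quartic[of y] p y assms tanh_real_nonneg_iff[of y] cosh_real_pos[of y]
      by (intro mult_mono) (auto intro: order_trans[of _ "tanh y"])
    moreover have "(y - y ^ 3 / 3 + 2 * y ^ 5 / 15) * (1 - y\<^sup>2 / 2 + 5 * y ^ 4 / 24) =
       y - 5 * y ^ 3 / 6 + 61 * y ^ 5 / 120 - y ^ 7 * (49 / 360 - y\<^sup>2 / 36)"
      by (simp add: field_simps eval_nat_numeral)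
    moreover have "0 \<le> y ^ 7 * (49 / 360 - y\<^sup>2 / 36)" using p y by simp
    ultimately show "- y + 5 * y ^ 3 / 6 - 61 * y ^ 5 / 120 \<le> - (tanh y / cosh y)" by simp
  qed (rule sech_has_deriv)
  moreover have "61 * x ^ 6 / 720 \<le> x ^ 4 / 120"
  proof -
    have "x\<^sup>2 \<le> (28/100)\<^sup>2" using assms by (intro power_mono) auto
    then have "x ^ 4 * x\<^sup>2 \<le> x ^ 4 * (6 / 61)" by (intro mult_left_mono) (auto simp: power2_eq_square)
    then show ?thesis by (simp add: power_add[symmetric])
  qed
  ultimately show ?thesis by simp
qed

text \<open>Partial sums of the Taylor series at 0, each obtained by integrating the preceding one.\<close>

lemma cos_ge2:
  fixes x :: real
  assumes "0 \<le> x"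
  shows "1 - x\<^sup>2 / 2 \<le> cos x"
proof -
  have "(\<lambda>x. 1 - x\<^sup>2 / 2) x - (\<lambda>x. 1 - x\<^sup>2 / 2) 0 \<le> cos x - cos 0"
  proof (rule increment_mono[OF assms, where F' = "\<lambda>x. - x" and G' = "\<lambda>x. - sin x"])
    fix y :: real assume "0 \<le> y"
    show "(\<lambda>x. - x) y \<le> (\<lambda>x. - sin x) y" using sin_x_le_x[OF \<open>0 \<le> y\<close>] by (simp add: field_simps)
  qed (auto intro!: derivative_eq_intros)
  then show ?thesis by simp
qed

lemma sin_ge3:
  fixes x :: real
  assumes "0 \<le> x"
  shows "x - x ^ 3 / 6 \<le> sin x"
proof -
  have "(\<lambda>x. x - x ^ 3 / 6) x - (\<lambda>x. x - x ^ 3 / 6) 0 \<le> sin x - sin 0"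
  proof (rule increment_mono[OF assms, where F' = "\<lambda>x. 1 - x\<^sup>2 / 2" and G' = "\<lambda>x. cos x"])
    fix y :: real assume "0 \<le> y"
    show "(\<lambda>x. 1 - x\<^sup>2 / 2) y \<le> (\<lambda>x. cos x) y" using cos_ge2[OF \<open>0 \<le> y\<close>] by (simp add: field_simps)
  qed (auto intro!: derivative_eq_intros)
  then show ?thesis by simp
qed

lemma cos_le4:
  fixes x :: real
  assumes "0 \<le> x"
  shows "cos x \<le> 1 - x\<^sup>2 / 2 + x ^ 4 / 24"
proof -
  have "cos x - cos 0 \<le> (\<lambda>x. 1 - x\<^sup>2 / 2 + x ^ 4 / 24) x - (\<lambda>x. 1 - x\<^sup>2 / 2 + x ^ 4 / 24) 0"
  proof (rule increment_mono[OF assms, where F' = "\<lambda>x. - sin x" and G' = "\<lambda>x. - x + x ^ 3 / 6"])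
    fix y :: real assume "0 \<le> y"
    show "(\<lambda>x. - sin x) y \<le> (\<lambda>x. - x + x ^ 3 / 6) y" using sin_ge3[OF \<open>0 \<le> y\<close>] by (simp add: field_simps)
  qed (auto intro!: derivative_eq_intros)
  then show ?thesis by simp
qed

lemma sin_le5:
  fixes x :: real
  assumes "0 \<le> x"
  shows "sin x \<le> x - x ^ 3 / 6 + x ^ 5 / 120"
proof -
  have "sin x - sin 0 \<le> (\<lambda>x. x - x ^ 3 / 6 + x ^ 5 / 120) x - (\<lambda>x. x - x ^ 3 / 6 + x ^ 5 / 120) 0"
  proof (rule increment_mono[OF assms, where F' = "\<lambda>x. cos x" and G' = "\<lambda>x. 1 - x\<^sup>2 / 2 + x ^ 4 / 24"])
    fix y :: real assume "0 \<le> y"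
    show "(\<lambda>x. cos x) y \<le> (\<lambda>x. 1 - x\<^sup>2 / 2 + x ^ 4 / 24) y" using cos_le4[OF \<open>0 \<le> y\<close>] by (simp add: field_simps)
  qed (auto intro!: derivative_eq_intros)
  then show ?thesis by simp
qed

lemma cos_ge6:
  fixes x :: real
  assumes "0 \<le> x"
  shows "1 - x\<^sup>2 / 2 + x ^ 4 / 24 - x ^ 6 / 720 \<le> cos x"
proof -
  have "(\<lambda>x. 1 - x\<^sup>2 / 2 + x ^ 4 / 24 - x ^ 6 / 720) x - (\<lambda>x. 1 - x\<^sup>2 / 2 + x ^ 4 / 24 - x ^ 6 / 720) 0 \<le> cos x - cos 0"
  proof (rule increment_mono[OF assms, where F' = "\<lambda>x. - x + x ^ 3 / 6 - x ^ 5 / 120" and G' = "\<lambda>x. - sin x"])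
    fix y :: real assume "0 \<le> y"
    show "(\<lambda>x. - x + x ^ 3 / 6 - x ^ 5 / 120) y \<le> (\<lambda>x. - sin x) y" using sin_le5[OF \<open>0 \<le> y\<close>] by (simp add: field_simps)
  qed (auto intro!: derivative_eq_intros)
  then show ?thesis by simp
qed

lemma sin_ge7:
  fixes x :: real
  assumes "0 \<le> x"
  shows "x - x ^ 3 / 6 + x ^ 5 / 120 - x ^ 7 / 5040 \<le> sin x"
proof -
  have "(\<lambda>x. x - x ^ 3 / 6 + x ^ 5 / 120 - x ^ 7 / 5040) x - (\<lambda>x. x - x ^ 3 / 6 + x ^ 5 / 120 - x ^ 7 / 5040) 0 \<le> sin x - sin 0"
  proof (rule increment_mono[OF assms, where F' = "\<lambda>x. 1 - x\<^sup>2 / 2 + x ^ 4 / 24 - x ^ 6 / 720" and G' = "\<lambda>x. cos x"])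
    fix y :: real assume "0 \<le> y"
    show "(\<lambda>x. 1 - x\<^sup>2 / 2 + x ^ 4 / 24 - x ^ 6 / 720) y \<le> (\<lambda>x. cos x) y" using cos_ge6[OF \<open>0 \<le> y\<close>] by (simp add: field_simps)
  qed (auto intro!: derivative_eq_intros)
  then show ?thesis by simp
qed

text \<open>
  The coefficients are tuned to \<open>[0, 0.53]\<close>, which contains the range of \<open>2 phi_app\<close>; there these quintics are much
  closer to \<open>tan\<close> than Taylor polynomials of that degree. The proof clears the denominator
  in \<open>sin / cos\<close> and leaves a polynomial in \<open>w = z\<^sup>2\<close>.
\<close>

lemma tan_lower:
  fixes z :: real assumes "0 \<le> z" "z \<le> 53/100"
  shows "z + 33/100 * z ^ 3 + 16/100 * z ^ 5 \<le> tan z"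
proof -
  have c: "cos z > 0" using assms pi_gt3 by (intro cos_gt_zero_pi) auto
  define w where "w = z\<^sup>2"
  have w: "0 \<le> w" "w \<le> 281/1000"
    using assms power_mono[of z "53/100" 2] by (auto simp: w_def power2_eq_square)
  have "0 \<le> 1/300 - 17/600 * w + 3329/50400 * w\<^sup>2 - w ^ 3 / 150"
  proof -
    have "w * w\<^sup>2 \<le> 281/1000 * w\<^sup>2" by (intro mult_right_mono w) simp
    then have "w ^ 3 \<le> 281/1000 * w\<^sup>2" by (simp add: eval_nat_numeral)
    \<comment> \<open>The quadratic left by the previous bound has its minimum near \<open>w = 0.221\<close>.\<close>
    moreover have "0 \<le> (w - 221/1000)\<^sup>2" by simp
    then have "w\<^sup>2 \<ge> 442/1000 * w - 48841/1000000" by (simp add: power2_diff) (simp add: power2_eq_square)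
    ultimately show ?thesis using w by linarith
  qed
  then have "0 \<le> z ^ 3 * (1/300 - 17/600 * w + 3329/50400 * w\<^sup>2 - w ^ 3 / 150)"
    using assms by simp
  also have "\<dots> = (z - z ^ 3 / 6 + z ^ 5 / 120 - z ^ 7 / 5040) - (z + 33/100 * z ^ 3 + 16/100 * z ^ 5) * (1 - z\<^sup>2 / 2 + z ^ 4 / 24)"
    unfolding w_def by (simp add: field_simps eval_nat_numeral)
  finally have "(z + 33/100 * z ^ 3 + 16/100 * z ^ 5) * (1 - z\<^sup>2 / 2 + z ^ 4 / 24) \<le> sin z"
    using sin_ge7[OF assms(1)] by simp
  moreover have "(z + 33/100 * z ^ 3 + 16/100 * z ^ 5) * cos z \<le> (z + 33/100 * z ^ 3 + 16/100 * z ^ 5) * (1 - z\<^sup>2 / 2 + z ^ 4 / 24)"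
    using assms by (intro mult_left_mono cos_le4) auto
  ultimately show ?thesis using c by (simp add: tan_def field_simps)
qed

lemma tan_upper:
  fixes z :: real assumes "0 \<le> z" "z \<le> 53/100"
  shows "tan z \<le> z + 334/1000 * z ^ 3 + 149/1000 * z ^ 5"
proof -
  have c: "cos z > 0" using assms pi_gt3 by (intro cos_gt_zero_pi) auto
  define w where "w = z\<^sup>2"
  have w: "0 \<le> w" "w \<le> 281/1000"
    using assms power_mono[of z "53/100" 2] by (auto simp: w_def power2_eq_square)
  have "0 \<le> 1/1500 + 23/1500 * w - 2231/36000 * w\<^sup>2 + 517/90000 * w ^ 3 - 149/720000 * w ^ 4"
  proof -
    have "w * w \<le> 281/1000 * w" by (intro mult_right_mono w)
    then have "w\<^sup>2 \<le> 281/1000 * w" by (simp add: power2_eq_square)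
    moreover have "w ^ 4 \<le> w ^ 3" "0 \<le> w ^ 3" using w power_decreasing[of 3 4 w] by auto
    ultimately show ?thesis using w by linarith
  qed
  then have "0 \<le> z ^ 3 * (1/1500 + 23/1500 * w - 2231/36000 * w\<^sup>2 + 517/90000 * w ^ 3 - 149/720000 * w ^ 4)"
    using assms by simp
  also have "\<dots> = (z + 334/1000 * z ^ 3 + 149/1000 * z ^ 5) * (1 - z\<^sup>2 / 2 + z ^ 4 / 24 - z ^ 6 / 720) - (z - z ^ 3 / 6 + z ^ 5 / 120)"
    unfolding w_def by (simp add: field_simps eval_nat_numeral)
  finally have "sin z \<le> (z + 334/1000 * z ^ 3 + 149/1000 * z ^ 5) * (1 - z\<^sup>2 / 2 + z ^ 4 / 24 - z ^ 6 / 720)"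
    using sin_le5[OF assms(1)] by simp
  moreover have "(z + 334/1000 * z ^ 3 + 149/1000 * z ^ 5) * (1 - z\<^sup>2 / 2 + z ^ 4 / 24 - z ^ 6 / 720) \<le> (z + 334/1000 * z ^ 3 + 149/1000 * z ^ 5) * cos z"
    using assms by (intro mult_left_mono cos_ge6) auto
  ultimately show ?thesis using c by (simp add: tan_def field_simps)
qed

lemma tanh_upper: assumes "0 \<le> x" "x \<le> 27/100" shows "tanh (x::real) \<le> x - 323/1000 * x ^ 3"
proof -
  have "x\<^sup>2 \<le> (27/100)\<^sup>2" using assms by (intro power_mono) auto
  then have "x ^ 3 * x\<^sup>2 \<le> x ^ 3 * (775/10000)" using assms by (intro mult_left_mono) (auto simp: power2_eq_square)
  then have "x ^ 5 \<le> x ^ 3 * (775/10000)" by (simp add: power_add[symmetric])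
  then show ?thesis using tanh_le_quintic[of x] assms by simp
qed

section \<open>The reduced equation and its approximate solution\<close>

text \<open>
  With \<open>b = \<alpha> - pi / 2\<close>, \<open>p = pi / 4 - \<theta>\<close> and \<open>sin (pi / 2 - r) = tanh R\<close> the equation for
  \<open>\<alpha>\<close> becomes \<open>b' = - cosh R * rate b R p\<close>. The variable \<open>R\<close> is the inverse Gudermannian of
  \<open>pi / 2 - r\<close>; it is used because \<open>dR / db = - sin b / rate\<close> then contains no \<open>R\<close> on the right
  besides the one in \<open>rate\<close>.
\<close>

definition rate :: "real \<Rightarrow> real \<Rightarrow> real \<Rightarrow> real" where
  "rate b R p = 2 * (sin b * tan (2 * p)) + 3 * (cos b * tanh R + 1 / cosh R)"

lemma rate_minus: "rate (- b) R (- p) = rate b R p"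
  by (simp add: rate_def)

text \<open>
  The coefficients come from a numerical solution: \<open>1 / rate\<close> is an even, \<open>pi\<close>-periodic
  function of \<open>b\<close> when extended by symmetry, hence a function of \<open>sin\<^sup>2 b\<close>, and it is affine in
  \<open>sin\<^sup>2 b\<close> up to about \<open>10\<^sup>-\<^sup>4\<close>. An affine approximation has the further advantage that its
  integrals against \<open>sin\<close> and \<open>cos\<close> are the cubic polynomials \<open>R_app\<close> and \<open>phi_app\<close>.
\<close>

definition g_app :: "real \<Rightarrow> real" where
  "g_app b = 2743/10000 - 339/10000 * (sin b)\<^sup>2"

text \<open>The integral of \<open>sin * g_app\<close> from \<open>b\<close> to \<open>pi / 2\<close>.\<close>

definition R_app :: "real \<Rightarrow> real" where
  "R_app b = cos b * (2404/10000 + 113/10000 * (cos b)\<^sup>2)"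

text \<open>The integral of \<open>cos * g_app\<close> from \<open>0\<close> to \<open>b\<close>.\<close>

definition phi_app :: "real \<Rightarrow> real" where
  "phi_app b = sin b * (2743/10000 - 113/10000 * (sin b)\<^sup>2)"

lemma sin_cos_quadrant:
  assumes "0 \<le> b" "b \<le> pi / 2"
  shows "0 \<le> sin b" "sin b \<le> 1" "0 \<le> cos b" "cos b \<le> 1"
  using assms by (auto intro!: sin_ge_zero cos_ge_zero)

text \<open>
  The residual of \<open>g_app\<close> involves the odd powers of \<open>phi_app = s Q\<close> and the powers of
  \<open>R_app = c P\<close>, where \<open>s = sin b\<close>, \<open>c = cos b\<close>, and \<open>Q\<close>, \<open>P\<close> are affine in \<open>x = s\<^sup>2\<close> and
  \<open>y = c\<^sup>2\<close>. Since both factors vary by only about five per cent, their powers lie in narrow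
  affine bands, which keeps the degree of the final inequalities at five.
\<close>

lemma phi_factor_power_bounds:
  fixes x :: real assumes x: "0 \<le> x" "x \<le> 1" and Q: "Q = 2743/10000 - 113/10000 * x"
  shows "206/10000 - 255/100000 * x \<le> Q ^ 3" "Q ^ 3 \<le> 2064/100000 - 244/100000 * x"
    "155/100000 - 32/100000 * x \<le> Q ^ 5" "Q ^ 5 \<le> 1553/1000000 - 29/100000 * x"
proof -
  have p: "0 \<le> x\<^sup>2" "x\<^sup>2 \<le> x" "x ^ 3 \<le> x\<^sup>2" "0 \<le> x ^ 3"  "0 \<le> x ^ 4" "x ^ 4 \<le> x ^ 3" "x ^ 5 \<le> x ^ 4" "0 \<le> x ^ 5"
    using x power_decreasing[of 1 2 x] power_decreasing[of 2 3 x] power_decreasing[of 3 4 x] power_decreasing[of 4 5 x] by auto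
  have 3: "Q ^ 3 = (2743/10000) ^ 3 - 3 * (2743/10000)\<^sup>2 * (113/10000) * x + 3 * (2743/10000) * (113/10000)\<^sup>2 * x\<^sup>2 - (113/10000) ^ 3 * x ^ 3"
    unfolding Q by (simp add: field_simps eval_nat_numeral)
  have 5: "Q ^ 5 = (2743/10000) ^ 5 - 5 * (2743/10000) ^ 4 * (113/10000) * x + 10 * (2743/10000) ^ 3 * (113/10000)\<^sup>2 * x\<^sup>2
     - 10 * (2743/10000)\<^sup>2 * (113/10000) ^ 3 * x ^ 3 + 5 * (2743/10000) * (113/10000) ^ 4 * x ^ 4 - (113/10000) ^ 5 * x ^ 5"
    unfolding Q by (simp add: field_simps eval_nat_numeral)
  show "206/10000 - 255/100000 * x \<le> Q ^ 3" unfolding 3 by (simp add: field_simps) (use p x in linarith)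
  show "Q ^ 3 \<le> 2064/100000 - 244/100000 * x" unfolding 3 by (simp add: field_simps) (use p x in linarith)
  show "155/100000 - 32/100000 * x \<le> Q ^ 5" unfolding 5 by (simp add: field_simps) (use p x in linarith)
  show "Q ^ 5 \<le> 1553/1000000 - 29/100000 * x" unfolding 5 by (simp add: field_simps) (use p x in linarith)
qed

lemma R_factor_power_bounds:
  fixes y :: real assumes y: "0 \<le> y" "y \<le> 1" and P: "P = 2404/10000 + 113/10000 * y"
  shows "1389/100000 + 195/100000 * y \<le> P ^ 3" "P ^ 3 \<le> 139/10000 + 206/100000 * y"
    "333/100000 + 62/100000 * y \<le> P ^ 4" "P ^ 4 \<le> 335/100000 + 68/100000 * y"
proof -
  have p: "0 \<le> y\<^sup>2" "y\<^sup>2 \<le> y" "y ^ 3 \<le> y\<^sup>2" "0 \<le> y ^ 3"  "0 \<le> y ^ 4" "y ^ 4 \<le> y ^ 3"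
    using y power_decreasing[of 1 2 y] power_decreasing[of 2 3 y] power_decreasing[of 3 4 y] by auto
  have 3: "P ^ 3 = (2404/10000) ^ 3 + 3 * (2404/10000)\<^sup>2 * (113/10000) * y + 3 * (2404/10000) * (113/10000)\<^sup>2 * y\<^sup>2 + (113/10000) ^ 3 * y ^ 3"
    unfolding P by (simp add: field_simps eval_nat_numeral)
  have 4: "P ^ 4 = (2404/10000) ^ 4 + 4 * (2404/10000) ^ 3 * (113/10000) * y + 6 * (2404/10000)\<^sup>2 * (113/10000)\<^sup>2 * y\<^sup>2
     + 4 * (2404/10000) * (113/10000) ^ 3 * y ^ 3 + (113/10000) ^ 4 * y ^ 4"
    unfolding P by (simp add: field_simps eval_nat_numeral)
  show "1389/100000 + 195/100000 * y \<le> P ^ 3" unfolding 3 by (simp add: field_simps) (use p y in linarith)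
  show "P ^ 3 \<le> 139/10000 + 206/100000 * y" unfolding 3 by (simp add: field_simps) (use p y in linarith)
  show "333/100000 + 62/100000 * y \<le> P ^ 4" unfolding 4 by (simp add: field_simps) (use p y in linarith)
  show "P ^ 4 \<le> 335/100000 + 68/100000 * y" unfolding 4 by (simp add: field_simps) (use p y in linarith)
qed

text \<open>
  These two inequalities say \<open>|1 / rate - g_app| \<le> 7/40000\<close> along the approximate solution, after every
  transcendental function has been replaced by its polynomial bound. Both are strict on
  \<open>[0, 1]\<close> with a margin of about \<open>2 * 10\<^sup>-\<^sup>4\<close>, so that a few elementary facts about powers of
  \<open>x\<close> and one or two well-placed squares certify them linearly.
\<close>

lemma residual_polynomial_lower:
  fixes x :: real assumes x: "0 \<le> x" "x \<le> 1" and y: "y = 1 - x"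
  shows "1 \<le> (2743/10000 - 339/10000 * x + 7/40000) *
     (2 * (x * (2 * (2743/10000 - 113/10000 * x) + 264/100 * (x * (206/10000 - 255/100000 * x)) + 512/100 * (x\<^sup>2 * (155/100000 - 32/100000 * x)))) +
      3 * ((y * (2404/10000 + 113/10000 * y) - y\<^sup>2 * (139/10000 + 206/100000 * y) / 3) + (1
         - y * (2404/10000 + 113/10000 * y)\<^sup>2 / 2 + y\<^sup>2 * (333/100000 + 62/100000 * y) / 5)))"
proof -
  have b: "x * (x * x) \<le> x * x" "x * (x * (x * x)) \<le> x * x" "0 \<le> x * (x * (x * (x * x)))"
    using x power_decreasing[of 2 3 x] power_decreasing[of 2 4 x] by (auto simp: eval_nat_numeral)
  \<comment> \<open>Bounding the cubic and quartic terms by \<open>x\<^sup>2\<close> leaves a quadratic with minimum near 0.54.\<close>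
  have "0 \<le> (x - 27/50)\<^sup>2" by simp
  then have "27/25 * x - 729/2500 \<le> x * x" by (simp add: power2_eq_square algebra_simps)
  then show ?thesis unfolding y by (simp add: field_simps eval_nat_numeral(2,3)) (use b x in linarith)
qed

lemma residual_polynomial_upper:
  fixes x :: real assumes x: "0 \<le> x" "x \<le> 1" and y: "y = 1 - x"
  shows "(2743/10000 - 339/10000 * x - 7/40000) *
     (2 * (x * (2 * (2743/10000 - 113/10000 * x) + 2672/1000 * (x * (2064/100000 - 244/100000 * x)) + 4768/1000 * (x\<^sup>2 * (1553/1000000 - 29/100000 * x)))) +
      3 * ((y * (2404/10000 + 113/10000 * y) - 323/1000 * (y\<^sup>2 * (1389/100000 + 195/100000 * y))) + (1
         - y * (2404/10000 + 113/10000 * y)\<^sup>2 / 2 + 5 * (y\<^sup>2 * (335/100000 + 68/100000 * y)) / 24))) \<le> 1"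
proof -
  have b: "x ^ 5 \<le> x ^ 4" "x ^ 2 \<le> x" using x power_decreasing[of 4 5 x] power_decreasing[of 1 2 x] by auto
  \<comment> \<open>The difference of the two sides is small at \<open>0\<close> and near \<open>1\<close>; the squares bound its cubic
    and quartic terms sharply near \<open>1\<close>.\<close>
  have "0 \<le> x * (x - 1)\<^sup>2" "0 \<le> x\<^sup>2 * (x - 9/10)\<^sup>2" using x by auto
  then show ?thesis unfolding y by (simp add: field_simps eval_nat_numeral(2,3)) (use b x in \<open>simp add: eval_nat_numeral(2,3)\<close>)
qed

text \<open>
  With \<open>z = 2 s Q\<close> and \<open>R = c P\<close>, the products \<open>s tan z\<close>, \<open>c tanh R\<close> and \<open>1 / cosh R\<close> are even in
  \<open>s\<close> and in \<open>c\<close>, so their polynomial bounds depend on \<open>x = s\<^sup>2\<close> and \<open>y = 1 - x\<close> only.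
\<close>

lemma rate_app_residual:
  assumes b: "0 \<le> b" "b \<le> pi / 2"
  shows "1 \<le> (g_app b + 7/40000) * rate b (R_app b) (phi_app b)"
    and "(g_app b - 7/40000) * rate b (R_app b) (phi_app b) \<le> 1"
proof -
  define s c x y where "s = sin b" and "c = cos b" and "x = s\<^sup>2" and "y = c\<^sup>2"
  have s: "0 \<le> s" "s \<le> 1" and c: "0 \<le> c" "c \<le> 1"
    using sin_cos_quadrant[OF b] by (auto simp: s_def c_def)
  have x: "0 \<le> x" "x \<le> 1" and y: "0 \<le> y" "y \<le> 1" and xy: "y = 1 - x"
    using s c by (auto simp: x_def y_def s_def c_def power_le_one cos_squared_eq)
  define Q where "Q = 2743/10000 - 113/10000 * x"
  define P where "P = 2404/10000 + 113/10000 * y"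
  define z where "z = 2 * (s * Q)"
  define R where "R = c * P"
  have p: "2 * phi_app b = z" "R_app b = R"
    by (simp_all add: phi_app_def R_app_def z_def R_def Q_def P_def s_def c_def x_def y_def)
  have K: "rate b (R_app b) (phi_app b) = 2 * (s * tan z) + 3 * (c * tanh R + 1 / cosh R)"
    by (simp add: rate_def p s_def c_def)
  have g: "g_app b = 2743/10000 - 339/10000 * x" by (simp add: g_app_def x_def s_def)
  have Q01: "0 \<le> Q" using x by (simp add: Q_def)
  have P01: "0 \<le> P" "P \<le> 27/100" using y by (auto simp: P_def)
  have z: "0 \<le> z" "z \<le> 53/100"
  proof -
    show "0 \<le> z" using s Q01 by (simp add: z_def)
    have "s\<^sup>2 \<le> 1" using s by (simp add: power_le_one)
    \<comment> \<open>This product is \<open>0.263 - s Q\<close>.\<close>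
    then have "0 \<le> (1 - s) * (263/1000 - 113/10000 * s - 113/10000 * s\<^sup>2)"
      using s by (intro mult_nonneg_nonneg) auto
    then show "z \<le> 53/100" using s unfolding z_def Q_def x_def
      by (simp add: field_simps eval_nat_numeral)
  qed
  have R: "0 \<le> R" "R \<le> 27/100" "R \<le> 1" "R \<le> 28/100"
    using c P01 mult_mono[of c 1 P "27/100"] by (auto simp: R_def)
  have tl: "x * (2 * Q + 264/100 * (x * Q ^ 3) + 512/100 * (x\<^sup>2 * Q ^ 5)) \<le> s * tan z"
  proof -
    have "s * (z + 33/100 * z ^ 3 + 16/100 * z ^ 5) \<le> s * tan z"
      by (intro mult_left_mono tan_lower z s)
    then show ?thesis by (simp add: z_def x_def field_simps eval_nat_numeral)
  qed
  have tu: "s * tan z \<le> x * (2 * Q + 2672/1000 * (x * Q ^ 3) + 4768/1000 * (x\<^sup>2 * Q ^ 5))"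
  proof -
    have "s * tan z \<le> s * (z + 334/1000 * z ^ 3 + 149/1000 * z ^ 5)"
      by (intro mult_left_mono tan_upper z s)
    then show ?thesis by (simp add: z_def x_def field_simps eval_nat_numeral)
  qed
  have hl: "y * P - y\<^sup>2 * P ^ 3 / 3 \<le> c * tanh R"
  proof -
    have "c * (R - R ^ 3 / 3) \<le> c * tanh R"
      by (intro mult_left_mono tanh_ge_cubic R c)
    then show ?thesis by (simp add: R_def y_def field_simps eval_nat_numeral)
  qed
  have hu: "c * tanh R \<le> y * P - 323/1000 * (y\<^sup>2 * P ^ 3)"
  proof -
    have "c * tanh R \<le> c * (R - 323/1000 * R ^ 3)"
      by (intro mult_left_mono tanh_upper R c)
    then show ?thesis by (simp add: R_def y_def field_simps eval_nat_numeral)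
  qed
  have cl: "1 - y * P\<^sup>2 / 2 + y\<^sup>2 * P ^ 4 / 5 \<le> 1 / cosh R"
    using sech_ge_quartic[of R] R by (simp add: R_def y_def power_mult_distrib)
  have cu: "1 / cosh R \<le> 1 - y * P\<^sup>2 / 2 + 5 * (y\<^sup>2 * P ^ 4) / 24"
    using sech_le_quartic[of R] R by (simp add: R_def y_def power_mult_distrib mult.assoc)
  note Qb = phi_factor_power_bounds[OF x Q_def] and Pb = R_factor_power_bounds[OF y P_def]
  have P3: "y\<^sup>2 * (1389/100000 + 195/100000 * y) \<le> y\<^sup>2 * P ^ 3" "y\<^sup>2 * P ^ 3 \<le> y\<^sup>2 * (139/10000 + 206/100000 * y)"
    and P4: "y\<^sup>2 * (333/100000 + 62/100000 * y) \<le> y\<^sup>2 * P ^ 4" "y\<^sup>2 * P ^ 4 \<le> y\<^sup>2 * (335/100000 + 68/100000 * y)"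
    by (intro mult_left_mono Pb; simp)+
  have tl': "x * (2 * Q + 264/100 * (x * (206/10000 - 255/100000 * x)) + 512/100 * (x\<^sup>2 * (155/100000 - 32/100000 * x)))
      \<le> s * tan z"
    by (rule order_trans[OF _ tl]) (intro mult_left_mono add_mono order_refl Qb x; use x in simp)
  have tu': "s * tan z \<le> x * (2 * Q + 2672/1000 * (x * (2064/100000 - 244/100000 * x)) + 4768/1000 * (x\<^sup>2 * (1553/1000000 - 29/100000 * x)))"
    by (rule order_trans[OF tu]) (intro mult_left_mono add_mono order_refl Qb x; use x in simp)
  have hl': "y * P - y\<^sup>2 * (139/10000 + 206/100000 * y) / 3 \<le> c * tanh R"
    by (rule order_trans[OF _ hl]) (intro diff_mono divide_right_mono order_refl P3; simp)
  have hu': "c * tanh R \<le> y * P - 323/1000 * (y\<^sup>2 * (1389/100000 + 195/100000 * y))"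
    by (rule order_trans[OF hu]) (intro diff_mono mult_left_mono[of _ _ "323/1000"] order_refl P3; simp)
  have cl': "1 - y * P\<^sup>2 / 2 + y\<^sup>2 * (333/100000 + 62/100000 * y) / 5 \<le> 1 / cosh R"
    by (rule order_trans[OF _ cl]) (intro add_left_mono divide_right_mono P4; simp)
  have cu': "1 / cosh R \<le> 1 - y * P\<^sup>2 / 2 + 5 * (y\<^sup>2 * (335/100000 + 68/100000 * y)) / 24"
    by (rule order_trans[OF cu]) (intro add_left_mono divide_right_mono mult_left_mono[of _ _ 5] P4; simp)
  let ?K = "rate b (R_app b) (phi_app b)"
  have "1 \<le> (g_app b + 7/40000) *
     (2 * (x * (2 * Q + 264/100 * (x * (206/10000 - 255/100000 * x)) + 512/100 * (x\<^sup>2 * (155/100000 - 32/100000 * x)))) +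
      3 * ((y * P - y\<^sup>2 * (139/10000 + 206/100000 * y) / 3) + (1
         - y * P\<^sup>2 / 2 + y\<^sup>2 * (333/100000 + 62/100000 * y) / 5)))"
    using residual_polynomial_lower[OF x xy] by (simp only: Q_def P_def g)
  also have "\<dots> \<le> (g_app b + 7/40000) * ?K"
    unfolding K by (intro mult_left_mono add_mono tl' hl' cl') (use x in \<open>simp_all add: g\<close>)
  finally show "1 \<le> (g_app b + 7/40000) * ?K" .
  have "(g_app b - 7/40000) * ?K \<le> (g_app b - 7/40000) *
     (2 * (x * (2 * Q + 2672/1000 * (x * (2064/100000 - 244/100000 * x)) + 4768/1000 * (x\<^sup>2 * (1553/1000000 - 29/100000 * x)))) +
      3 * ((y * P - 323/1000 * (y\<^sup>2 * (1389/100000 + 195/100000 * y))) + (1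
         - y * P\<^sup>2 / 2 + 5 * (y\<^sup>2 * (335/100000 + 68/100000 * y)) / 24)))"
    unfolding K by (intro mult_left_mono add_mono tu' hu' cu') (use x in \<open>simp_all add: g\<close>)
  also have "\<dots> \<le> 1"
    using residual_polynomial_upper[OF x xy] by (simp only: Q_def P_def g)
  finally show "(g_app b - 7/40000) * ?K \<le> 1" .
qed

section \<open>Lower bound and Lipschitz bound for the rate\<close>

text \<open>
  For small \<open>R\<close> and \<open>p\<close> the rate exceeds 3 by about \<open>4 p sin b + 3 R cos b\<close>, and the lower bounds
  on \<open>p\<close> and \<open>R\<close> turn this into a positive definite form in \<open>(sin b, cos b)\<close>. Half a unit of
  gain over 3 is what brings the contraction constant \<open>6 / rate\<^sup>2\<close> below one half.
\<close>

lemma rate_lower: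
  assumes b: "0 \<le> b" "b \<le> pi / 2"
    and R: "23/100 * cos b \<le> R" "R \<le> 28/100 * cos b"
    and p: "23/100 * sin b \<le> p" "p \<le> 275/1000 * sin b"
  shows "7/2 \<le> rate b R p"
proof -
  define s c where "s = sin b" and "c = cos b"
  have s: "0 \<le> s" "s \<le> 1" and c: "0 \<le> c" "c \<le> 1" and sc: "s\<^sup>2 + c\<^sup>2 = 1"
    using sin_cos_quadrant[OF b] by (auto simp: s_def c_def)
  note R = R[folded c_def] and p = p[folded s_def]
  have R0: "0 \<le> R" and p0: "0 \<le> p" "p \<le> 275/1000" using R p s c by auto
  have "2 * p \<le> tan (2 * p)"
  proof -
    have pos: "0 < cos x" if "0 \<le> x" "x \<le> 2 * p" for x
      using that p0 pi_gt3 by (intro cos_gt_zero_pi) auto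
    have "(\<lambda>x. x) (2 * p) - (\<lambda>x. x) 0 \<le> tan (2 * p) - tan 0"
    proof (rule increment_mono)
      fix x assume x: "0 \<le> x" "x \<le> 2 * p"
      show "(tan has_real_derivative inverse ((cos x)\<^sup>2)) (at x)"
        using pos[OF x] by (auto intro!: derivative_eq_intros)
      show "1 \<le> inverse ((cos x)\<^sup>2)" using pos[OF x] by (simp add: one_le_inverse power_le_one)
    qed (use p0 in \<open>auto intro!: derivative_eq_intros\<close>)
    then show ?thesis by simp
  qed
  then have "s * (2 * (23/100 * s)) \<le> s * tan (2 * p)" using s p by (intro mult_left_mono) auto
  then have 1: "46/100 * s\<^sup>2 \<le> s * tan (2 * p)" by (simp add: power2_eq_square)
  have "R * R \<le> 28/100 * (28/100)" using R c R0 by (intro mult_mono) auto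
  then have "c * (R * R) \<le> c * (8/100)" using c by (intro mult_left_mono) auto
  then have "R * (8/10 * c) \<le> R * (c - R / 2 - c * (R * R) / 3)"
    using R0 R c by (intro mult_left_mono) auto
  also have "\<dots> = c * (R - R ^ 3 / 3) + (1 - R\<^sup>2 / 2) - 1" by (simp add: field_simps eval_nat_numeral)
  also have "\<dots> \<le> c * tanh R + 1 / cosh R - 1"
    using mult_left_mono[OF tanh_ge_cubic[OF R0] c(1)] sech_ge_quadratic[OF R0] by linarith
  finally have "R * (8/10 * c) \<le> c * tanh R + 1 / cosh R - 1" .
  moreover have "23/100 * c * (8/10 * c) \<le> R * (8/10 * c)" using R c by (intro mult_right_mono) auto
  ultimately have 2: "184/1000 * c\<^sup>2 \<le> c * tanh R + 1 / cosh R - 1" by (simp add: power2_eq_square)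
  have "c\<^sup>2 \<le> 1" using c by (simp add: power_le_one)
  have "7/2 \<le> 2 * u + 3 * v"
    if "46/100 * s\<^sup>2 \<le> u" "184/1000 * c\<^sup>2 \<le> v - 1" for u v
    using that sc \<open>c\<^sup>2 \<le> 1\<close> by linarith
  from this[OF 1 2] show ?thesis by (simp add: rate_def s_def c_def)
qed

lemma tan_lipschitz_le:
  fixes a b :: real
  assumes "0 \<le> a" "a \<le> b" "b \<le> 55/100"
  shows "\<bar>tan b - tan a\<bar> \<le> 139/100 * (b - a)"
proof -
  have cos_ge: "8487/10000 \<le> cos x" if "a \<le> x" "x \<le> b" for x
  proof -
    have "x\<^sup>2 \<le> (55/100)\<^sup>2" using that assms by (intro power_mono) auto
    then show ?thesis using cos_ge2[of x] that assms by (simp add: power2_eq_square)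
  qed
  have *: "inverse ((cos x)\<^sup>2) \<le> 139/100" if "a \<le> x" "x \<le> b" for x
  proof -
    have "(8487/10000)\<^sup>2 \<le> (cos x)\<^sup>2" using cos_ge[OF that] by (intro power_mono) auto
    then have "inverse ((cos x)\<^sup>2) \<le> inverse ((8487/10000)\<^sup>2)" by (intro le_imp_inverse_le) auto
    then show ?thesis by (rule order_trans) (simp add: power2_eq_square)
  qed
  have d: "(tan has_real_derivative inverse ((cos x)\<^sup>2)) (at x)" if "a \<le> x" "x \<le> b" for x
  proof -
    have "cos x \<noteq> 0" using cos_ge[OF that] by linarith
    then show ?thesis by (auto intro!: derivative_eq_intros)
  qed
  have "tan b - tan a \<le> (\<lambda>x. 139/100 * x) b - (\<lambda>x. 139/100 * x) a"
    by (rule increment_mono[OF assms(2) d _ *]) (auto intro!: derivative_eq_intros)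
  moreover have "(\<lambda>x. 0) b - (\<lambda>x. 0) a \<le> tan b - tan a"
    by (rule increment_mono[OF assms(2) _ d, where F = "\<lambda>_. 0" and F' = "\<lambda>_. 0"]) (auto intro!: derivative_eq_intros)
  ultimately show ?thesis by simp
qed

lemma tan_lipschitz:
  fixes a b :: real
  assumes "0 \<le> a" "a \<le> 55/100" "0 \<le> b" "b \<le> 55/100"
  shows "\<bar>tan a - tan b\<bar> \<le> 139/100 * \<bar>a - b\<bar>"
  using tan_lipschitz_le[of a b] tan_lipschitz_le[of b a] assms by (cases "a \<le> b") (auto simp: abs_minus_commute)

text \<open>
  The derivative in the argument is \<open>c (1 - tanh\<^sup>2) - tanh / cosh\<close>, a difference of two
  numbers in \<open>[0, 1]\<close>, so no cancellation has to be exploited.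
\<close>

lemma hyperbolic_lipschitz:
  fixes a b c :: real
  assumes c: "0 \<le> c" "c \<le> 1" and "0 \<le> a" "0 \<le> b"
  shows "\<bar>(c * tanh a + 1 / cosh a) - (c * tanh b + 1 / cosh b)\<bar> \<le> \<bar>a - b\<bar>"
proof -
  have *: "\<bar>(c * tanh b + 1 / cosh b) - (c * tanh a + 1 / cosh a)\<bar> \<le> b - a" if "0 \<le> a" "a \<le> b" for a b :: real
  proof -
    have d: "((\<lambda>x. c * tanh x + 1 / cosh x) has_real_derivative c * (1 - (tanh x)\<^sup>2) - tanh x / cosh x) (at x)" for x :: real
      using DERIV_add[OF DERIV_cmult[OF tanh_has_deriv] sech_has_deriv, of c x] by simp
    have t: "0 \<le> tanh x" "tanh x \<le> 1" if "0 \<le> x" for x :: real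
      using that tanh_real_lt_1[of x] by auto
    have u: "c * (1 - (tanh x)\<^sup>2) \<le> 1" "0 \<le> c * (1 - (tanh x)\<^sup>2)" if "0 \<le> x" for x :: real
      using c t[OF that] mult_mono[of c 1 "1 - (tanh x)\<^sup>2" 1] by (auto simp: power_le_one)
    have v: "0 \<le> tanh x / cosh x" "tanh x / cosh x \<le> 1" if "0 \<le> x" for x :: real
      using t[OF that] cosh_real_ge_1[of x] by (auto simp: divide_le_eq)
    have "(c * tanh b + 1 / cosh b) - (c * tanh a + 1 / cosh a) \<le> (\<lambda>x. x) b - (\<lambda>x. x) a"
    proof (rule increment_mono[OF that(2) d, where G = "\<lambda>x. x" and G' = "\<lambda>_. 1"])
      fix x assume "a \<le> x"
      then show "c * (1 - (tanh x)\<^sup>2) - tanh x / cosh x \<le> 1"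
        using u[of x] v[of x] \<open>0 \<le> a\<close> by linarith
    qed simp
    moreover have "(\<lambda>x. - x) b - (\<lambda>x. - x) a \<le> (c * tanh b + 1 / cosh b) - (c * tanh a + 1 / cosh a)"
    proof (rule increment_mono[OF that(2) _ d, where F = "\<lambda>x. - x" and F' = "\<lambda>_. - 1"])
      fix x assume "a \<le> x"
      then show "- 1 \<le> c * (1 - (tanh x)\<^sup>2) - tanh x / cosh x"
        using u[of x] v[of x] \<open>0 \<le> a\<close> by linarith
    qed (auto intro!: derivative_eq_intros)
    ultimately show ?thesis by simp
  qed
  show ?thesis using *[of a b] *[of b a] assms by (cases "a \<le> b") (auto simp: abs_minus_commute)
qed

text \<open>
  Here the two angular factors are what saves the estimate: \<open>tan (2 p)\<close> carries the factor
  \<open>sin b\<close> and its argument varies by \<open>e sin b\<close>, while the hyperbolic part varies only by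
  \<open>e cos b\<close>. The resulting bound \<open>5.56 sin\<^sup>2 b + 3 cos b\<close> stays below 6, although the
  maxima of its two terms add up to more than 8.
\<close>

lemma rate_lipschitz:
  assumes b: "0 \<le> b" "b \<le> pi / 2"
    and p: "0 \<le> p" "p \<le> 275/1000" "0 \<le> p'" "p' \<le> 275/1000" and R: "0 \<le> R" "0 \<le> R'"
    and dp: "\<bar>p - p'\<bar> \<le> e * sin b" and dR: "\<bar>R - R'\<bar> \<le> e * cos b" and e: "0 \<le> e"
  shows "\<bar>rate b R p - rate b R' p'\<bar> \<le> 6 * e"
proof -
  define s c where "s = sin b" and "c = cos b"
  have s: "0 \<le> s" "s \<le> 1" and c: "0 \<le> c" "c \<le> 1" and sc: "s\<^sup>2 + c\<^sup>2 = 1"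
    using sin_cos_quadrant[OF b] by (auto simp: s_def c_def)
  have "\<bar>tan (2 * p) - tan (2 * p')\<bar> \<le> 139/100 * \<bar>2 * p - 2 * p'\<bar>"
    using p by (intro tan_lipschitz) auto
  also have "\<dots> \<le> 278/100 * (e * s)" using dp by (simp add: s_def)
  finally have "s * \<bar>tan (2 * p) - tan (2 * p')\<bar> \<le> s * (278/100 * (e * s))" by (rule mult_left_mono) fact
  then have 1: "\<bar>s * tan (2 * p) - s * tan (2 * p')\<bar> \<le> 278/100 * (e * s\<^sup>2)"
    using s abs_mult[of s "tan (2 * p) - tan (2 * p')"] by (simp add: power2_eq_square algebra_simps)
  have 2: "\<bar>(c * tanh R + 1 / cosh R) - (c * tanh R' + 1 / cosh R')\<bar> \<le> e * c"
    using hyperbolic_lipschitz[OF c R] dR by (simp add: c_def)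
  \<comment> \<open>The quadratic \<open>5.56 (1 - c\<^sup>2) + 3 c\<close> is largest near \<open>c = 3 / 11\<close>.\<close>
  have "0 \<le> (c - 3/11)\<^sup>2" by simp
  then have "556/100 * s\<^sup>2 + 3 * c \<le> 6" using sc c by (simp add: power2_eq_square algebra_simps)
  then have "e * (556/100 * s\<^sup>2 + 3 * c) \<le> e * 6" using e by (rule mult_left_mono)
  then have 3: "2 * (278/100 * (e * s\<^sup>2)) + 3 * (e * c) \<le> 6 * e" by (simp add: algebra_simps)
  have "\<bar>(2 * u + 3 * v) - (2 * u' + 3 * v')\<bar> \<le> 2 * m + 3 * n"
    if "\<bar>u - u'\<bar> \<le> m" "\<bar>v - v'\<bar> \<le> n" for u v u' v' m n :: real
    using that unfolding abs_le_iff by linarith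
  from order_trans[OF this[OF 1 2] 3] show ?thesis
    by (simp only: rate_def s_def c_def)
qed

section \<open>Preliminary bounds for the time integral\<close>

text \<open>
  Affine bounds in \<open>x = sin\<^sup>2 b\<close> for \<open>g_app / cosh R_app\<close>, with \<open>1 / cosh\<close> already replaced by its
  polynomial bounds. The lower line is nearly the chord of a concave function; the gap
  \<open>7 * 10\<^sup>-\<^sup>4\<close> covers the curvature.
\<close>

lemma slowness_polynomials:
  fixes x :: real assumes x: "0 \<le> x" "x \<le> 1" and y: "y = 1 - x"
  shows "26558/100000 - 252/10000 * x \<le> (2743/10000 - 339/10000 * x) * (1 - y * (2404/10000 + 113/10000 * y)\<^sup>2 / 2)"
    "(2743/10000 - 339/10000 * x) * (1 - 4837/10000 * (y * (2404/10000 + 113/10000 * y)\<^sup>2)) \<le> 26628/100000 - 252/10000 * x"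
proof -
  have b: "0 \<le> (1 - x) ^ 4" "0 \<le> x * (1 - x) ^ 3" "0 \<le> x ^ 2 * (1 - x) ^ 2" "0 \<le> x ^ 3 * (1 - x)" "0 \<le> x ^ 4"
    using x by auto
  show "26558/100000 - 252/10000 * x \<le> (2743/10000 - 339/10000 * x) * (1 - y * (2404/10000 + 113/10000 * y)\<^sup>2 / 2)"
    using b unfolding y by (simp add: field_simps eval_nat_numeral)
  \<comment> \<open>The difference of the two sides is smallest near \<open>x = 2 / 5\<close>.\<close>
  have "0 \<le> (x - 2/5)\<^sup>2" "0 \<le> x * (x - 2/5)\<^sup>2" "0 \<le> (1 - x) * (x - 2/5)\<^sup>2" using x by auto
  then show "(2743/10000 - 339/10000 * x) * (1 - 4837/10000 * (y * (2404/10000 + 113/10000 * y)\<^sup>2)) \<le> 26628/100000 - 252/10000 * x"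
    using b unfolding y by (simp add: field_simps eval_nat_numeral)
qed

lemma sech_lipschitz:
  fixes a b l :: real
  assumes a: "0 \<le> a" "a \<le> l" and b: "0 \<le> b" "b \<le> l"
  shows "\<bar>1 / cosh a - 1 / cosh b\<bar> \<le> l * \<bar>a - b\<bar>"
proof -
  have *: "\<bar>1 / cosh a - 1 / cosh b\<bar> \<le> l * (b - a)" if "0 \<le> a" "a \<le> b" "b \<le> l" for a b :: real
  proof -
    have v: "0 \<le> tanh x / cosh x" "tanh x / cosh x \<le> l" if "a \<le> x" "x \<le> b" for x
    proof -
      have x: "0 \<le> x" "x \<le> l" using that \<open>0 \<le> a\<close> \<open>b \<le> l\<close> by auto
      then show "0 \<le> tanh x / cosh x" using cosh_real_pos[of x] by simp
      have "tanh x * (1 / cosh x) \<le> x * 1"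
        using x tanh_le[of x] sech_le_one[of x] cosh_real_pos[of x] by (intro mult_mono) auto
      then show "tanh x / cosh x \<le> l" using x by simp
    qed
    have "(\<lambda>x. - l * x) b - (\<lambda>x. - l * x) a \<le> 1 / cosh b - 1 / cosh a"
    proof (rule increment_mono[OF that(2) _ sech_has_deriv, where F = "\<lambda>x. - l * x" and F' = "\<lambda>_. - l"])
      fix x assume "a \<le> x" "x \<le> b"
      then show "- l \<le> - (tanh x / cosh x)" using v[of x] by linarith
    qed (auto intro!: derivative_eq_intros)
    moreover have "1 / cosh b - 1 / cosh a \<le> (\<lambda>_. 0) b - (\<lambda>_. 0) a"
    proof (rule increment_mono[OF that(2) sech_has_deriv, where G = "\<lambda>_. 0" and G' = "\<lambda>_. 0"])
      fix x assume "a \<le> x" "x \<le> b"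
      then show "- (tanh x / cosh x) \<le> 0" using v[of x] by linarith
    qed auto
    ultimately show ?thesis by (simp add: algebra_simps)
  qed
  show ?thesis using *[of a b] *[of b a] assms by (cases "a \<le> b") (auto simp: abs_minus_commute)
qed

section \<open>The two integrals of a profile\<close>

text \<open>
  An antiderivative vanishing at 0, defined with the base point -4 to avoid oriented
  integrals. The interval \<open>[-4, 4]\<close> is any interval containing \<open>[- pi / 2, pi / 2]\<close> in its
  interior, so that two-sided derivatives exist at \<open>\<plusminus> pi / 2\<close>.
\<close>

definition antideriv :: "(real \<Rightarrow> real) \<Rightarrow> real \<Rightarrow> real" where
  "antideriv f x = integral {-4..x} f - integral {-4..0} f"

lemma antideriv_0 [simp]: "antideriv f 0 = 0"
  by (simp add: antideriv_def)

lemma antideriv_has_deriv_within: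
  assumes "continuous_on {-4..4} f" "- 4 \<le> x" "x \<le> 4"
  shows "(antideriv f has_real_derivative f x) (at x within {-4..4})"
proof -
  have "((\<lambda>x. integral {-4..x} f) has_real_derivative f x) (at x within {-4..4})"
    using assms by (intro integral_has_real_derivative) auto
  from DERIV_diff[OF this DERIV_const[of "integral {-4..0} f"]] show ?thesis
    by (simp add: antideriv_def[abs_def])
qed

lemma antideriv_has_deriv:
  assumes "continuous_on {-4..4} f" "- 4 < x" "x < 4"
  shows "(antideriv f has_real_derivative f x) (at x)"
  using antideriv_has_deriv_within[OF assms(1), of x] assms by (simp add: at_within_Icc_at)

lemma antideriv_continuous:
  assumes "continuous_on {-4..4} f"
  shows "continuous_on {-4..4} (antideriv f)"
  using antideriv_has_deriv_within[OF assms]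
  by (intro DERIV_continuous_on) auto

text \<open>
  Both boundary conditions of the problem are limits of integration: \<open>\<theta> = pi / 4\<close> at \<open>b = 0\<close>
  makes \<open>phi_of\<close> start at \<open>0\<close>, and \<open>r = pi / 2\<close> at \<open>b = pi / 2\<close> makes \<open>R_of\<close> end at \<open>pi / 2\<close>.
\<close>

definition phi_of :: "(real \<Rightarrow> real) \<Rightarrow> real \<Rightarrow> real" where
  "phi_of g = antideriv (\<lambda>y. cos y * g y)"

definition R_of :: "(real \<Rightarrow> real) \<Rightarrow> real \<Rightarrow> real" where
  "R_of g b = antideriv (\<lambda>y. sin y * g y) (pi / 2) - antideriv (\<lambda>y. sin y * g y) b"

lemma phi_of_0 [simp]: "phi_of g 0 = 0" by (simp add: phi_of_def)

lemma R_of_pi_half [simp]: "R_of g (pi / 2) = 0" by (simp add: R_of_def)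

lemma phi_of_has_deriv:
  assumes "continuous_on UNIV g" "- 4 < b" "b < 4"
  shows "(phi_of g has_real_derivative cos b * g b) (at b)"
  unfolding phi_of_def
  by (intro antideriv_has_deriv continuous_intros continuous_on_subset[OF assms(1)] assms(2,3)) auto

lemma R_of_has_deriv:
  assumes "continuous_on UNIV g" "- 4 < b" "b < 4"
  shows "(R_of g has_real_derivative - (sin b * g b)) (at b)"
proof -
  have "(antideriv (\<lambda>y. sin y * g y) has_real_derivative sin b * g b) (at b)"
    by (intro antideriv_has_deriv continuous_intros continuous_on_subset[OF assms(1)] assms(2,3)) auto
  from DERIV_diff[OF DERIV_const this, of "antideriv (\<lambda>y. sin y * g y) (pi / 2)"] show ?thesis
    by (simp add: R_of_def[abs_def])
qed

lemma integrals_continuous: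
  assumes "continuous_on UNIV g"
  shows "continuous_on {-4..4} (phi_of g)" "continuous_on {-4..4} (R_of g)"
  unfolding phi_of_def R_of_def[abs_def]
  by (intro antideriv_continuous continuous_intros continuous_on_subset[OF assms]; simp)+

lemma pi_half_less_4: "pi / 2 < 4" using pi_less_4 by simp

text \<open>
  The next four lemmas compare an integral of \<open>g\<close> with an explicit antiderivative \<open>H\<close> belonging
  to a bound \<open>h\<close> of \<open>g\<close>; every estimate of \<open>phi_of\<close> and \<open>R_of\<close> below is an instance.
\<close>

lemma phi_of_le:
  assumes g: "continuous_on UNIV g" and b: "0 \<le> b" "b \<le> pi / 2"
    and H: "\<And>y. 0 \<le> y \<Longrightarrow> y \<le> pi / 2 \<Longrightarrow> (H has_real_derivative cos y * h y) (at y)" "H 0 = 0"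
    and le: "\<And>y. 0 \<le> y \<Longrightarrow> y \<le> pi / 2 \<Longrightarrow> g y \<le> h y"
  shows "phi_of g b \<le> H b"
proof -
  have "phi_of g b - phi_of g 0 \<le> H b - H 0"
    by (rule increment_mono[OF b(1) phi_of_has_deriv[OF g] H(1)])
      (use b pi_half_less_4 le sin_cos_quadrant in \<open>auto intro!: mult_left_mono\<close>)
  then show ?thesis by (simp add: H)
qed

lemma phi_of_ge:
  assumes g: "continuous_on UNIV g" and b: "0 \<le> b" "b \<le> pi / 2"
    and H: "\<And>y. 0 \<le> y \<Longrightarrow> y \<le> pi / 2 \<Longrightarrow> (H has_real_derivative cos y * h y) (at y)" "H 0 = 0"
    and le: "\<And>y. 0 \<le> y \<Longrightarrow> y \<le> pi / 2 \<Longrightarrow> h y \<le> g y"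
  shows "H b \<le> phi_of g b"
proof -
  have "H b - H 0 \<le> phi_of g b - phi_of g 0"
    by (rule increment_mono[OF b(1) H(1) phi_of_has_deriv[OF g]])
      (use b pi_half_less_4 le sin_cos_quadrant in \<open>auto intro!: mult_left_mono\<close>)
  then show ?thesis by (simp add: H)
qed

lemma R_of_le:
  assumes g: "continuous_on UNIV g" and b: "0 \<le> b" "b \<le> pi / 2"
    and H: "\<And>y. 0 \<le> y \<Longrightarrow> y \<le> pi / 2 \<Longrightarrow> (H has_real_derivative - (sin y * h y)) (at y)" "H (pi / 2) = 0"
    and le: "\<And>y. 0 \<le> y \<Longrightarrow> y \<le> pi / 2 \<Longrightarrow> g y \<le> h y"
  shows "R_of g b \<le> H b"
proof -
  have "H (pi / 2) - H b \<le> R_of g (pi / 2) - R_of g b"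
    by (rule increment_mono[OF b(2) H(1) R_of_has_deriv[OF g]])
      (use b pi_half_less_4 le sin_cos_quadrant in \<open>auto intro!: mult_left_mono\<close>)
  then show ?thesis by (simp add: H)
qed

lemma R_of_ge:
  assumes g: "continuous_on UNIV g" and b: "0 \<le> b" "b \<le> pi / 2"
    and H: "\<And>y. 0 \<le> y \<Longrightarrow> y \<le> pi / 2 \<Longrightarrow> (H has_real_derivative - (sin y * h y)) (at y)" "H (pi / 2) = 0"
    and le: "\<And>y. 0 \<le> y \<Longrightarrow> y \<le> pi / 2 \<Longrightarrow> h y \<le> g y"
  shows "H b \<le> R_of g b"
proof -
  have "R_of g (pi / 2) - R_of g b \<le> H (pi / 2) - H b"
    by (rule increment_mono[OF b(2) R_of_has_deriv[OF g] H(1)])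
      (use b pi_half_less_4 le sin_cos_quadrant in \<open>auto intro!: mult_left_mono\<close>)
  then show ?thesis by (simp add: H)
qed

text \<open>
  The factors \<open>sin b\<close> and \<open>cos b\<close>, rather than the constant 1, are what \<open>rate_lipschitz\<close> relies on.
\<close>

lemma integrals_lipschitz:
  assumes g: "continuous_on UNIV g" and h: "continuous_on UNIV h" and b: "0 \<le> b" "b \<le> pi / 2"
    and le: "\<And>y. 0 \<le> y \<Longrightarrow> y \<le> pi / 2 \<Longrightarrow> \<bar>g y - h y\<bar> \<le> e"
  shows "\<bar>phi_of g b - phi_of h b\<bar> \<le> e * sin b" "\<bar>R_of g b - R_of h b\<bar> \<le> e * cos b"
proof -
  have le': "g y \<le> h y + e" "h y - e \<le> g y" if "0 \<le> y" "y \<le> pi / 2" for y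
    using le[OF that] by auto
  have "phi_of g b \<le> (\<lambda>b. phi_of h b + e * sin b) b"
    by (rule phi_of_le[OF g b, where h = "\<lambda>y. h y + e"])
      (use pi_half_less_4 le' in \<open>auto intro!: derivative_eq_intros phi_of_has_deriv h simp: algebra_simps\<close>)
  moreover have "(\<lambda>b. phi_of h b - e * sin b) b \<le> phi_of g b"
    by (rule phi_of_ge[OF g b, where h = "\<lambda>y. h y - e"])
      (use pi_half_less_4 le' in \<open>auto intro!: derivative_eq_intros phi_of_has_deriv h simp: algebra_simps\<close>)
  ultimately show "\<bar>phi_of g b - phi_of h b\<bar> \<le> e * sin b" by simp
  have "R_of g b \<le> (\<lambda>b. R_of h b + e * cos b) b"
    by (rule R_of_le[OF g b, where h = "\<lambda>y. h y + e"])
      (use pi_half_less_4 le' in \<open>auto intro!: derivative_eq_intros R_of_has_deriv h simp: algebra_simps\<close>)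
  moreover have "(\<lambda>b. R_of h b - e * cos b) b \<le> R_of g b"
    by (rule R_of_ge[OF g b, where h = "\<lambda>y. h y - e"])
      (use pi_half_less_4 le' in \<open>auto intro!: derivative_eq_intros R_of_has_deriv h simp: algebra_simps\<close>)
  ultimately show "\<bar>R_of g b - R_of h b\<bar> \<le> e * cos b" by simp
qed

lemma g_app_cont: "continuous_on UNIV g_app"
  unfolding g_app_def[abs_def] by (intro continuous_intros)

lemma g_app_bounds: "2404/10000 \<le> g_app b" "g_app b \<le> 2743/10000"
proof -
  have "(sin b)\<^sup>2 \<le> 1" by (simp add: abs_square_le_1)
  moreover have "0 \<le> (sin b)\<^sup>2" by simp
  ultimately show "2404/10000 \<le> g_app b" "g_app b \<le> 2743/10000" unfolding g_app_def by linarith+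
qed

lemma integrals_of_g_app:
  assumes b: "0 \<le> b" "b \<le> pi / 2"
  shows "phi_of g_app b = phi_app b" "R_of g_app b = R_app b"
proof -
  have p: "(phi_app has_real_derivative cos y * g_app y) (at y)" for y
    unfolding phi_app_def[abs_def] g_app_def
    by (auto intro!: derivative_eq_intros simp: field_simps eval_nat_numeral)
  have R: "(R_app has_real_derivative - (sin y * g_app y)) (at y)" for y
    unfolding R_app_def[abs_def] g_app_def sin_squared_eq
    by (auto intro!: derivative_eq_intros simp: field_simps eval_nat_numeral)
  show "phi_of g_app b = phi_app b"
    by (rule antisym; (rule phi_of_le[OF g_app_cont b p] | rule phi_of_ge[OF g_app_cont b p])) (simp_all add: phi_app_def)
  show "R_of g_app b = R_app b"
    by (rule antisym; (rule R_of_le[OF g_app_cont b R] | rule R_of_ge[OF g_app_cont b R])) (simp_all add: R_app_def)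
qed

section \<open>The profile as a fixed point\<close>

text \<open>
  The radius \<open>7/20000\<close> is twice the residual bound \<open>7/40000\<close>: a map with contraction constant
  one half then maps the ball into itself. It is also small enough for both numerical claims
  about \<open>a\<close> and the hitting time.
\<close>

definition near_app :: "(real \<Rightarrow> real) \<Rightarrow> bool" where
  "near_app g \<longleftrightarrow> continuous_on UNIV g \<and> (\<forall>y\<in>{0..pi/2}. \<bar>g y - g_app y\<bar> \<le> 7/20000)"

lemma g_app_near: "near_app g_app" by (simp add: near_app_def g_app_cont)

lemma near_app_bounds:
  assumes "near_app g" "0 \<le> b" "b \<le> pi / 2"
  shows "24/100 \<le> g b" "g b \<le> 275/1000"
proof -
  have "\<bar>g b - g_app b\<bar> \<le> 7/20000" using assms by (auto simp: near_app_def)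
  then show "24/100 \<le> g b" "g b \<le> 275/1000" using g_app_bounds[of b] by linarith+
qed

lemma near_app_integrals:
  assumes n: "near_app g" and b: "0 \<le> b" "b \<le> pi / 2"
  shows "24/100 * sin b \<le> phi_of g b" "phi_of g b \<le> 275/1000 * sin b"
    "24/100 * cos b \<le> R_of g b" "R_of g b \<le> 275/1000 * cos b"
proof -
  have g: "continuous_on UNIV g" using n by (simp add: near_app_def)
  show "24/100 * sin b \<le> phi_of g b"
    by (rule phi_of_ge[OF g b, where h = "\<lambda>_. 24/100"]) (use near_app_bounds[OF n] in \<open>auto intro!: derivative_eq_intros\<close>)
  show "phi_of g b \<le> 275/1000 * sin b"
    by (rule phi_of_le[OF g b, where h = "\<lambda>_. 275/1000"]) (use near_app_bounds[OF n] in \<open>auto intro!: derivative_eq_intros\<close>)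
  show "24/100 * cos b \<le> R_of g b"
    by (rule R_of_ge[OF g b, where h = "\<lambda>_. 24/100"]) (use near_app_bounds[OF n] in \<open>auto intro!: derivative_eq_intros\<close>)
  show "R_of g b \<le> 275/1000 * cos b"
    by (rule R_of_le[OF g b, where h = "\<lambda>_. 275/1000"]) (use near_app_bounds[OF n] in \<open>auto intro!: derivative_eq_intros\<close>)
qed

lemma near_app_small:
  assumes n: "near_app g" and b: "0 \<le> b" "b \<le> pi / 2"
  shows "0 \<le> phi_of g b" "phi_of g b \<le> 275/1000" "0 \<le> R_of g b" "R_of g b \<le> 275/1000"
    "R_of g b \<le> 28/100 * cos b" "23/100 * cos b \<le> R_of g b" "23/100 * sin b \<le> phi_of g b"
  using near_app_integrals[OF assms] sin_cos_quadrant[OF b] by linarith+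

text \<open>
  Evaluating the operator at \<open>min (pi / 2) |b|\<close> makes its values even functions defined on
  the whole line. Estimates are needed on \<open>[0, pi / 2]\<close> only, and evenness later yields the
  equation on \<open>[- pi / 2, 0]\<close>, that is, for times beyond the hitting time.
\<close>

definition fold_abs :: "real \<Rightarrow> real" where
  "fold_abs b = min (pi / 2) \<bar>b\<bar>"

lemma fold_abs_range: "0 \<le> fold_abs b" "fold_abs b \<le> pi / 2" by (auto simp: fold_abs_def)

definition rate_of :: "(real \<Rightarrow> real) \<Rightarrow> real \<Rightarrow> real" where
  "rate_of g b = rate b (R_of g b) (phi_of g b)"

lemma rate_of_lower: "near_app g \<Longrightarrow> 0 \<le> b \<Longrightarrow> b \<le> pi / 2 \<Longrightarrow> 7/2 \<le> rate_of g b"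
  unfolding rate_of_def by (intro rate_lower near_app_small near_app_integrals)

definition picard :: "(real \<Rightarrow> real) \<Rightarrow> real \<Rightarrow> real" where
  "picard g b = 1 / rate_of g (fold_abs b)"

lemma picard_range: assumes "near_app g" shows "0 < picard g b" "picard g b \<le> 1"
  using rate_of_lower[OF assms fold_abs_range, of b] by (auto simp: picard_def)

text \<open>
  This is the contraction estimate: the factor is \<open>6 / (7/2)\<^sup>2\<close>, which is less than \<open>1 / 2\<close>.
\<close>

lemma rate_of_inverse_diff:
  assumes g: "near_app g" and h: "near_app h" and b: "0 \<le> b" "b \<le> pi / 2"
    and le: "\<And>y. 0 \<le> y \<Longrightarrow> y \<le> pi / 2 \<Longrightarrow> \<bar>g y - h y\<bar> \<le> e"
  shows "\<bar>1 / rate_of g b - 1 / rate_of h b\<bar> \<le> e / 2"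
proof -
  have e: "0 \<le> e" using le[of 0] by simp
  have gh: "continuous_on UNIV g" "continuous_on UNIV h" using g h by (auto simp: near_app_def)
  note K = rate_of_lower[OF g b] rate_of_lower[OF h b]
  have "\<bar>rate_of h b - rate_of g b\<bar> \<le> 6 * e" unfolding rate_of_def
    by (intro rate_lipschitz b near_app_small[OF g b] near_app_small[OF h b] integrals_lipschitz gh e)
      (use le in \<open>simp_all add: abs_minus_commute\<close>)
  also have "\<dots> \<le> e / 2 * (7/2 * (7/2))" using e by simp
  also have "\<dots> \<le> e / 2 * (rate_of g b * rate_of h b)" using K e by (intro mult_left_mono mult_mono) auto
  finally have "\<bar>rate_of h b - rate_of g b\<bar> / (rate_of g b * rate_of h b) \<le> e / 2" using K by (simp add: divide_le_eq)
  moreover have "1 / rate_of g b - 1 / rate_of h b = (rate_of h b - rate_of g b) / (rate_of g b * rate_of h b)"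
    using K by (simp add: field_simps)
  ultimately show ?thesis using K by (simp add: abs_mult)
qed

text \<open>
  On \<open>[0, pi / 2]\<close> the distance of \<open>picard g\<close> from \<open>g_app\<close> is at most half the radius by
  contraction plus the other half by the residual estimate.
\<close>

lemma picard_near_app:
  assumes n: "near_app g" shows "near_app (picard g)"
proof -
  have g: "continuous_on UNIV g" using n by (simp add: near_app_def)
  have c: "continuous_on {0..pi/2} (R_of g)" "continuous_on {0..pi/2} (phi_of g)"
    using pi_half_less_4 by (intro continuous_on_subset[OF integrals_continuous(1)[OF g]]
        continuous_on_subset[OF integrals_continuous(2)[OF g]]; simp)+
  have "cos (2 * phi_of g b) \<noteq> 0" if "b \<in> {0..pi/2}" for b
    using near_app_small[OF n, of b] that pi_gt3 by (intro less_imp_neq[symmetric] cos_gt_zero_pi) auto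
  moreover have "rate_of g b \<noteq> 0" if "b \<in> {0..pi/2}" for b using rate_of_lower[OF n, of b] that by auto
  ultimately have "continuous_on {0..pi/2} (\<lambda>b. 1 / rate_of g b)"
    unfolding rate_of_def rate_def using c cosh_real_pos by (intro continuous_intros) (auto simp: less_imp_neq[symmetric])
  moreover have "continuous_on UNIV fold_abs" unfolding fold_abs_def[abs_def] by (intro continuous_intros)
  ultimately have "continuous_on UNIV (picard g)"
    unfolding picard_def[abs_def] by (rule continuous_on_compose2) (use fold_abs_range in auto)
  moreover have "\<bar>picard g b - g_app b\<bar> \<le> 7/20000" if b: "b \<in> {0..pi/2}" for b
  proof -
    have fb: "fold_abs b = b" using b by (auto simp: fold_abs_def)
    have b': "0 \<le> b" "b \<le> pi / 2" using b by auto
    have "\<bar>1 / rate_of g b - 1 / rate_of g_app b\<bar> \<le> 7/20000 / 2"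
      using n b' by (intro rate_of_inverse_diff g_app_near) (auto simp: near_app_def)
    moreover have "\<bar>1 / rate_of g_app b - g_app b\<bar> \<le> 7/40000"
    proof -
      have "0 < rate_of g_app b" using rate_of_lower[OF g_app_near b'] by linarith
      then have "1 / rate_of g_app b \<le> g_app b + 7/40000" "g_app b - 7/40000 \<le> 1 / rate_of g_app b"
        using rate_app_residual[OF b'] unfolding rate_of_def integrals_of_g_app[OF b']
        by (simp_all only: pos_divide_le_eq pos_le_divide_eq)
      then show ?thesis by linarith
    qed
    ultimately show ?thesis unfolding picard_def fb by linarith
  qed
  ultimately show ?thesis by (simp add: near_app_def)
qed

lemma fixpoint_exists: "\<exists>g. near_app g \<and> (\<forall>b. g b = picard g b)"
proof -
  define S :: "(real \<Rightarrow>\<^sub>C real) set" where "S = {g. near_app (apply_bcontfun g)}"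
  have in_bc: "picard g \<in> bcontfun" if "near_app g" for g
  proof -
    have "bounded (range (picard g))" unfolding bounded_iff
      using picard_range[OF that] by (intro exI[of _ 1]) (auto simp: abs_of_pos)
    then show ?thesis using picard_near_app[OF that] by (auto simp: bcontfun_def near_app_def)
  qed
  \<comment> \<open>For \<open>g\<close> in \<open>S\<close> the function \<open>picard g\<close> is bounded and continuous, so \<open>T g\<close> represents it.\<close>
  define T where "T g = Bcontfun (picard (apply_bcontfun g))" for g :: "real \<Rightarrow>\<^sub>C real"
  have T: "apply_bcontfun (T g) = picard (apply_bcontfun g)" if "g \<in> S" for g
    using that in_bc by (simp add: T_def S_def Bcontfun_inverse)
  have "closed S"
  proof -
    have "S = (\<Inter>y\<in>{0..pi/2}. {g. dist (apply_bcontfun g y) (g_app y) \<le> 7/20000})"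
      by (auto simp: S_def near_app_def dist_real_def)
    moreover have "closed {g :: real \<Rightarrow>\<^sub>C real. dist (apply_bcontfun g y) (g_app y) \<le> 7/20000}" for y
    proof (rule closed_Collect_le)
      have "continuous_on UNIV (\<lambda>g :: real \<Rightarrow>\<^sub>C real. apply_bcontfun g y)"
        by (rule lipschitz_on_continuous_on[of 1]) (auto simp: lipschitz_on_def dist_bounded)
      then show "continuous_on UNIV (\<lambda>g :: real \<Rightarrow>\<^sub>C real. dist (apply_bcontfun g y) (g_app y))"
        by (intro continuous_intros)
    qed auto
    ultimately show ?thesis by auto
  qed
  moreover have "S \<noteq> {}"
  proof -
    have "g_app \<in> bcontfun" unfolding bcontfun_def bounded_iff
    proof (intro CollectI conjI g_app_cont exI[of _ 1] ballI)
      fix z assume "z \<in> range g_app"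
      then obtain b where "z = g_app b" by auto
      then show "norm z \<le> 1" using g_app_bounds[of b] by simp
    qed
    then have "Bcontfun g_app \<in> S" by (simp add: S_def Bcontfun_inverse g_app_near)
    then show ?thesis by auto
  qed
  moreover have "T ` S \<subseteq> S" using T picard_near_app by (auto simp: S_def)
  moreover have "dist (T g) (T h) \<le> 1/2 * dist g h" if gh: "g \<in> S" "h \<in> S" for g h
  proof (rule dist_bound)
    fix b
    have "\<bar>picard g b - picard h b\<bar> \<le> dist g h / 2" unfolding picard_def
      using gh dist_bounded[of g _ h]
      by (intro rate_of_inverse_diff fold_abs_range) (auto simp: S_def dist_real_def)
    then show "dist (T g b) (T h b) \<le> 1/2 * dist g h" by (simp add: T gh dist_real_def)
  qed
  ultimately have "\<exists>!g\<in>S. T g = g"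
    by (intro Banach_fix[where c = "1/2"]) (auto simp: complete_eq_closed)
  then obtain g where "g \<in> S" "T g = g" by auto
  then show ?thesis using T[of g] by (intro exI[of _ "apply_bcontfun g"]) (auto simp: S_def)
qed

section \<open>Symmetry of the profile\<close>

locale fixed_profile =
  fixes g :: "real \<Rightarrow> real"
  assumes near_app: "near_app g" and fixed: "\<And>b. g b = picard g b"
begin

lemma g_cont: "continuous_on UNIV g"
  using near_app by (simp add: near_app_def)

lemma g_pos: "0 < g b"
  using picard_range(1)[OF near_app, of b] fixed[of b] by simp

lemma g_even: "g (- b) = g b"
  by (subst (1 2) fixed) (simp add: picard_def fold_abs_def)

lemma R_of_even_nonneg: assumes "0 \<le> b" "b < 4" shows "R_of g (- b) = R_of g b"
proof -
  have d: "(R_of g has_real_derivative - (sin x * g x)) (at x)" if "0 \<le> x" "x \<le> b" for x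
    using that assms by (intro R_of_has_deriv g_cont) auto
  have d': "((\<lambda>x. R_of g (- x)) has_real_derivative - (sin x * g x)) (at x)" if "0 \<le> x" "x \<le> b" for x
  proof -
    have "(R_of g has_real_derivative - (sin (- x) * g (- x))) (at (- x))"
      using that assms by (intro R_of_has_deriv g_cont) auto
    then have "((\<lambda>x. R_of g (- x)) has_real_derivative - (sin (- x) * g (- x)) * (- 1)) (at x)"
      by (rule DERIV_chain2) (auto intro!: derivative_eq_intros)
    then show ?thesis by (simp add: g_even)
  qed
  show ?thesis
    using increment_mono[OF assms(1) d d'] increment_mono[OF assms(1) d' d] by force
qed

lemma phi_of_odd_nonneg: assumes "0 \<le> b" "b < 4" shows "phi_of g (- b) = - phi_of g b"
proof -
  have d: "(phi_of g has_real_derivative cos x * g x) (at x)" if "0 \<le> x" "x \<le> b" for x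
    using that assms by (intro phi_of_has_deriv g_cont) auto
  have d': "((\<lambda>x. - phi_of g (- x)) has_real_derivative cos x * g x) (at x)" if "0 \<le> x" "x \<le> b" for x
  proof -
    have "(phi_of g has_real_derivative cos (- x) * g (- x)) (at (- x))"
      using that assms by (intro phi_of_has_deriv g_cont) auto
    then have "((\<lambda>x. phi_of g (- x)) has_real_derivative cos (- x) * g (- x) * (- 1)) (at x)"
      by (rule DERIV_chain2) (auto intro!: derivative_eq_intros)
    from DERIV_minus[OF this] show ?thesis by (simp add: g_even)
  qed
  show ?thesis
    using increment_mono[OF assms(1) d d'] increment_mono[OF assms(1) d' d] by force
qed

lemma R_of_even: "\<bar>b\<bar> < 4 \<Longrightarrow> R_of g (- b) = R_of g b"
  using R_of_even_nonneg[of b] R_of_even_nonneg[of "- b"] by (cases "0 \<le> b") auto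

lemma phi_of_odd: "\<bar>b\<bar> < 4 \<Longrightarrow> phi_of g (- b) = - phi_of g b"
  using phi_of_odd_nonneg[of b] phi_of_odd_nonneg[of "- b"] by (cases "0 \<le> b") auto

text \<open>
  Since \<open>R_of g\<close> is even and \<open>phi_of g\<close> is odd, \<open>rate_minus\<close> carries the fixed point equation
  from \<open>|b|\<close> to \<open>b\<close>.
\<close>

lemma g_eq: assumes "\<bar>b\<bar> \<le> pi / 2" shows "g b * rate_of g b = 1"
proof -
  have "rate_of g \<bar>b\<bar> = rate_of g b"
    using assms pi_half_less_4 R_of_even[of b] phi_of_odd[of b]
    by (cases "0 \<le> b") (auto simp: rate_of_def rate_minus)
  then have "g b = 1 / rate_of g b" using assms fixed[of b] by (simp add: picard_def fold_abs_def)
  then show ?thesis using g_pos[of b] by auto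
qed

section \<open>Time as a function of the angle\<close>

text \<open>The time spent per unit of \<open>b\<close>, namely \<open>1 / (cosh R * rate)\<close>.\<close>

definition slowness :: "real \<Rightarrow> real" where
  "slowness b = g b / cosh (R_of g b)"

definition time :: "real \<Rightarrow> real" where
  "time b = antideriv slowness (pi / 2) - antideriv slowness b"

lemma slowness_pos: "0 < slowness b"
  using g_pos[of b] cosh_real_pos[of "R_of g b"] by (simp add: slowness_def)

lemma time_pi_half: "time (pi / 2) = 0" by (simp add: time_def)

lemma time_deriv: assumes "- 4 < b" "b < 4" shows "(time has_real_derivative - slowness b) (at b)"
proof -
  have "continuous_on {-4..4} slowness"
    unfolding slowness_def[abs_def] using cosh_real_pos
    by (intro continuous_intros integrals_continuous continuous_on_subset[OF g_cont] g_cont)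
      (auto simp: less_imp_neq[symmetric])
  from DERIV_diff[OF DERIV_const antideriv_has_deriv[OF this assms], of "antideriv slowness (pi / 2)"]
  show ?thesis by (simp add: time_def[abs_def])
qed

lemma time_less: assumes "- 4 < a" "a < b" "b < 4" shows "time b < time a"
proof (rule DERIV_neg_imp_decreasing[OF assms(2)])
  fix x assume "a \<le> x" "x \<le> b"
  then show "\<exists>y. (time has_real_derivative y) (at x) \<and> y < 0"
    using assms by (intro exI[of _ "- slowness x"] conjI time_deriv) (auto simp: slowness_pos)
qed

lemma time_inj: "inj_on time {-4<..<4}"
  by (rule linorder_inj_onI') (use time_less in fastforce)

text \<open>
  The affine bounds of \<open>slowness_polynomials\<close> are widened by \<open>0.000378\<close>, the effect of the
  distance \<open>7/20000\<close> between \<open>g\<close> and \<open>g_app\<close>: once directly and once, damped by \<open>|tanh / cosh| \<le> 0.28\<close>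
  and \<open>g_app \<le> 0.2743\<close>, through \<open>R_of\<close>.
\<close>

lemma slowness_bounds:
  assumes b: "0 \<le> b" "b \<le> pi / 2"
  shows "265202/1000000 - 252/10000 * (sin b)\<^sup>2 \<le> slowness b"
    and "slowness b \<le> 266658/1000000 - 252/10000 * (sin b)\<^sup>2"
proof -
  define x y where "x = (sin b)\<^sup>2" and "y = (cos b)\<^sup>2"
  have x: "0 \<le> x" "x \<le> 1" and xy: "y = 1 - x" and y: "0 \<le> y" "y \<le> 1"
    using sin_cos_quadrant[OF b] by (auto simp: x_def y_def power_le_one cos_squared_eq)
  have gh: "\<bar>g b - g_app b\<bar> \<le> 7/20000" using near_app b by (auto simp: near_app_def)
  have ghx: "g_app b = 2743/10000 - 339/10000 * x" by (simp add: g_app_def x_def)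
  have R0: "0 \<le> R_of g b" "R_of g b \<le> 28/100" using near_app_small[OF near_app b] by auto
  have Rh: "0 \<le> R_app b" "R_app b \<le> 27/100" and Rh2: "(R_app b)\<^sup>2 = y * (2404/10000 + 113/10000 * y)\<^sup>2"
  proof -
    show "(R_app b)\<^sup>2 = y * (2404/10000 + 113/10000 * y)\<^sup>2" by (simp add: R_app_def y_def power_mult_distrib)
    show "0 \<le> R_app b" using y sin_cos_quadrant[OF b] by (simp add: R_app_def flip: y_def)
    have "cos b * (2404/10000 + 113/10000 * y) \<le> 1 * (27/100)"
      using y sin_cos_quadrant[OF b] by (intro mult_mono) auto
    then show "R_app b \<le> 27/100" by (simp add: R_app_def y_def)
  qed
  have dR: "\<bar>R_of g b - R_app b\<bar> \<le> 7/20000"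
  proof -
    have "\<bar>R_of g b - R_of g_app b\<bar> \<le> 7/20000 * cos b"
      using near_app by (intro integrals_lipschitz g_cont g_app_cont b) (auto simp: near_app_def)
    also have "\<dots> \<le> 7/20000" using sin_cos_quadrant[OF b] by simp
    finally show ?thesis using integrals_of_g_app[OF b] by simp
  qed
  have ds: "\<bar>1 / cosh (R_of g b) - 1 / cosh (R_app b)\<bar> \<le> 28/100 * (7/20000)"
    using sech_lipschitz[of "R_of g b" "28/100" "R_app b"] R0 Rh dR by simp
  define S where "S = 1 / cosh (R_of g b)"
  define H where "H = 1 / cosh (R_app b)"
  have S: "0 \<le> S" "S \<le> 1" using cosh_real_pos[of "R_of g b"] sech_le_one by (auto simp: S_def)
  have sp: "slowness b = g b * S" by (simp add: slowness_def S_def)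
  have "\<bar>g b * S - g_app b * H\<bar> \<le> 378/1000000"
  proof -
    have "g b * S - g_app b * H = (g b - g_app b) * S + g_app b * (S - H)" by (simp add: algebra_simps)
    moreover have "\<bar>(g b - g_app b) * S\<bar> \<le> 7/20000 * 1"
      unfolding abs_mult using gh S by (intro mult_mono) auto
    moreover have "\<bar>g_app b * (S - H)\<bar> \<le> 2743/10000 * (28/100 * (7/20000))"
      unfolding abs_mult using ds g_app_bounds[of b] by (intro mult_mono) (auto simp: S_def H_def)
    ultimately show ?thesis by linarith
  qed
  moreover have "26558/100000 - 252/10000 * x \<le> g_app b * H"
  proof -
    have "26558/100000 - 252/10000 * x \<le> g_app b * (1 - (R_app b)\<^sup>2 / 2)"
      using slowness_polynomials(1)[OF x xy] by (simp only: Rh2 ghx)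
    also have "\<dots> \<le> g_app b * H" unfolding H_def
      using g_app_bounds[of b] Rh by (intro mult_left_mono sech_ge_quadratic) auto
    finally show ?thesis .
  qed
  moreover have "g_app b * H \<le> 26628/100000 - 252/10000 * x"
  proof -
    have "(R_app b)\<^sup>2 \<le> (27/100)\<^sup>2" using Rh by (intro power_mono) auto
    then have "(R_app b)\<^sup>2 * (R_app b)\<^sup>2 \<le> (R_app b)\<^sup>2 * (729/10000)"
      by (intro mult_left_mono) (auto simp: power2_eq_square)
    then have "R_app b ^ 4 \<le> 729/10000 * (R_app b)\<^sup>2" by (simp add: power_add[symmetric])
    then have "5 * R_app b ^ 4 / 24 \<le> 163/10000 * (R_app b)\<^sup>2" using zero_le_power2[of "R_app b"] by linarith
    then have "H \<le> 1 - 4837/10000 * (R_app b)\<^sup>2" unfolding H_def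
      using sech_le_quartic[of "R_app b"] Rh by simp
    then have "g_app b * H \<le> g_app b * (1 - 4837/10000 * (R_app b)\<^sup>2)"
      using g_app_bounds[of b] by (intro mult_left_mono) auto
    also have "\<dots> \<le> 26628/100000 - 252/10000 * x"
      using slowness_polynomials(2)[OF x xy] by (simp only: Rh2 ghx)
    finally show ?thesis .
  qed
  ultimately show "265202/1000000 - 252/10000 * (sin b)\<^sup>2 \<le> slowness b"
    "slowness b \<le> 266658/1000000 - 252/10000 * (sin b)\<^sup>2"
    unfolding sp x_def[symmetric] by linarith+
qed

text \<open>
  The bounds on \<open>slowness\<close> integrate over \<open>[0, pi / 2]\<close> to \<open>0.39678\<close> and \<open>0.39907\<close> approximately, the value
  of the hitting time being about \<open>0.39786\<close>.
\<close>

lemma time_0: "3966/10000 < time 0" "time 0 < 3991/10000"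
proof -
  \<comment> \<open>An antiderivative of \<open>w - 0.0252 sin\<^sup>2\<close>.\<close>
  define A :: "real \<Rightarrow> real \<Rightarrow> real" where "A w b = w * b - 252/10000 * (b / 2 - sin b * cos b / 2)" for w b
  have A: "(A w has_real_derivative w - 252/10000 * (sin b)\<^sup>2) (at b)" for w b
  proof -
    have "(A w has_real_derivative w - 252/10000 * (1 / 2 - ((cos b)\<^sup>2 - (sin b)\<^sup>2) / 2)) (at b)"
      unfolding A_def[abs_def]
      by (auto intro!: derivative_eq_intros simp: power2_eq_square field_simps)
    then show ?thesis by (simp add: cos_squared_eq field_simps)
  qed
  have t: "((\<lambda>b. - time b) has_real_derivative slowness b) (at b)" if "0 \<le> b" "b \<le> pi / 2" for b
    using DERIV_minus[OF time_deriv[of b]] that pi_half_less_4 by simp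
  have "A (265202/1000000) (pi/2) - A (265202/1000000) 0 \<le> - time (pi / 2) - - time 0"
    by (rule increment_mono[OF _ A t slowness_bounds(1)]) auto
  moreover have "- time (pi / 2) - - time 0 \<le> A (266658/1000000) (pi/2) - A (266658/1000000) 0"
    by (rule increment_mono[OF _ t A slowness_bounds(2)]) auto
  ultimately show "3966/10000 < time 0" "time 0 < 3991/10000"
    using pi_approx by (simp_all add: A_def time_pi_half)
qed

text \<open>This guarantees that the parametrisation by \<open>b\<close> covers the whole time interval of the claim.\<close>

lemma time_minus_pi_half: "3991/10000 \<le> time (- (pi / 2))"
proof -
  have "(\<lambda>b. 24/100 * b) 0 - (\<lambda>b. 24/100 * b) (- (pi/2)) \<le> - time 0 - - time (- (pi / 2))"
  proof (rule increment_mono)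
    fix b assume b: "- (pi / 2) \<le> b" "b \<le> 0"
    show "((\<lambda>b. - time b) has_real_derivative slowness b) (at b)"
      using DERIV_minus[OF time_deriv[of b]] b pi_half_less_4 by simp
    have "slowness b = slowness (- b)" using b pi_half_less_4 by (simp add: slowness_def g_even R_of_even)
    moreover have "(sin b)\<^sup>2 \<le> 1" by (simp add: abs_square_le_1)
    ultimately show "24/100 \<le> slowness b" using slowness_bounds(1)[of "- b"] b by simp
  qed (auto intro!: derivative_eq_intros)
  then show ?thesis using time_0(1) pi_approx by simp
qed

text \<open>The numbers behind this are \<open>phi_app (pi / 2) = 0.263\<close> and \<open>pi / 4 - 0.263 = 0.5224\<close>, approximately.\<close>

lemma initial_theta: "pi / 4 - phi_of g (pi / 2) \<in> {5204/10000<..<5244/10000}"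
proof -
  have "\<bar>phi_of g (pi / 2) - phi_of g_app (pi / 2)\<bar> \<le> 7/20000 * sin (pi / 2)"
    using near_app by (intro integrals_lipschitz g_cont g_app_cont) (auto simp: near_app_def)
  then have "\<bar>phi_of g (pi / 2) - 263/1000\<bar> \<le> 7/20000"
    by (simp add: integrals_of_g_app phi_app_def)
  moreover have "31415/10000 \<le> pi" "pi \<le> 31416/10000" using pi_approx by simp_all
  ultimately show ?thesis unfolding abs_le_iff greaterThanLessThan_iff by linarith
qed

section \<open>Return to the original variables\<close>

definition beta_at :: "real \<Rightarrow> real" where "beta_at = the_inv_into {-4<..<4} time"

lemma beta_at_time: "- 4 < b \<Longrightarrow> b < 4 \<Longrightarrow> beta_at (time b) = b"
  unfolding beta_at_def by (rule the_inv_into_f_f[OF time_inj]) auto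

lemma beta_at_deriv:
  assumes "- 4 < b" "b < 4"
  shows "(beta_at has_real_derivative - (cosh (R_of g b) / g b)) (at (time b))"
proof -
  have "continuous_on {-4<..<4} time"
    by (auto intro!: continuous_at_imp_continuous_on DERIV_isCont time_deriv)
  moreover have "(time has_derivative (*) (- slowness b)) (at b)"
    using time_deriv[OF assms] by (simp add: has_field_derivative_def)
  moreover have "(*) (- slowness b) \<circ> (*) (inverse (- slowness b)) = id"
    using slowness_pos[of b] by (auto simp: fun_eq_iff)
  ultimately have "(beta_at has_derivative (*) (inverse (- slowness b))) (at (time b))"
    using assms by (intro has_derivative_inverse_strong[of "{-4<..<4}" b time]) (auto simp: beta_at_time)
  moreover have "inverse (- slowness b) = - (cosh (R_of g b) / g b)"
    using g_pos[of b] by (simp add: slowness_def)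
  ultimately show ?thesis by (simp add: has_field_derivative_def)
qed

lemma time_surj: assumes "0 \<le> t" "t \<le> 3991/10000"
  obtains b where "\<bar>b\<bar> \<le> pi / 2" "time b = t"
proof -
  have "\<exists>b\<ge>- (pi/2). b \<le> pi/2 \<and> time b = t"
    using assms time_minus_pi_half time_pi_half pi_half_less_4
    by (intro IVT2) (auto intro!: DERIV_isCont[OF time_deriv])
  then obtain b where "- (pi / 2) \<le> b" "b \<le> pi / 2" "time b = t" by blast
  then show ?thesis by (intro that[of b]) (simp_all add: abs_le_iff)
qed

text \<open>
  As \<open>sin (pi / 2 - r) = tanh R\<close> and \<open>cos (pi / 2 - r) = 1 / cosh R\<close>, the angle \<open>pi / 2 - r\<close> has
  tangent \<open>sinh R\<close>.
\<close>

definition "r t = pi / 2 - arctan (sinh (R_of g (beta_at t)))"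
definition "\<theta> t = pi / 4 - phi_of g (beta_at t)"
definition "\<alpha> t = beta_at t + pi / 2"

lemma phi_of_abs: assumes "\<bar>b\<bar> \<le> pi / 2" shows "\<bar>phi_of g b\<bar> \<le> 275/1000"
  using near_app_small[OF near_app, of "\<bar>b\<bar>"] assms phi_of_odd[of b] pi_half_less_4 by (cases "0 \<le> b") auto

text \<open>
  The chain rule through \<open>beta_at\<close> recovers the system; the equation for \<open>\<alpha>\<close> is the fixed point
  equation, and the other two hold by the choice of \<open>R_of\<close> and \<open>phi_of\<close>.
\<close>

lemma solution: "solves_system r \<theta> \<alpha> {0..3991/10000}"
  unfolding solves_system_def
proof (intro ballI)
  fix t :: real assume "t \<in> {0..3991/10000}"
  then obtain b where b: "\<bar>b\<bar> \<le> pi / 2" and t: "t = time b" using time_surj[of t] by auto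
  have b4: "- 4 < b" "b < 4" using b pi_half_less_4 by auto
  have beta_at: "beta_at t = b" by (simp add: t beta_at_time b4)
  define R p where "R = R_of g b" and "p = phi_of g b"
  have ch: "0 < cosh R" by (rule cosh_real_pos)
  have g0: "0 < g b" by (rule g_pos)
  have sq: "1 + (sinh R)\<^sup>2 = (cosh R)\<^sup>2" by (simp add: cosh_square_eq)
  have sin_r: "sin (r t) = 1 / cosh R"
    using ch by (simp add: r_def beta_at sin_diff cos_arctan sq flip: R_def)
  have cos_r: "cos (r t) = sinh R / cosh R"
    using ch by (simp add: r_def beta_at cos_diff sin_arctan sq flip: R_def)
  have "\<bar>p\<bar> \<le> 275/1000" unfolding p_def by (rule phi_of_abs[OF b])
  then have cp: "0 < cos (2 * p)" using pi_gt3 by (intro cos_gt_zero_pi) auto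
  have th: "2 * \<theta> t = pi / 2 - 2 * p" by (simp add: \<theta>_def beta_at p_def)
  have cot_th: "cot (2 * \<theta> t) = tan (2 * p)" "sin (2 * \<theta> t) = cos (2 * p)"
    unfolding th by (simp_all add: cot_def tan_def sin_diff cos_diff)
  have al: "cos (\<alpha> t) = - sin b" "sin (\<alpha> t) = cos b" by (simp_all add: \<alpha>_def beta_at cos_add sin_add)
  have dbt: "(beta_at has_real_derivative - (cosh R / g b)) (at t within I)" for I
    unfolding t R_def by (rule has_field_derivative_at_within[OF beta_at_deriv[OF b4]])
  have dR: "((\<lambda>t. R_of g (beta_at t)) has_real_derivative - (sin b * g b) * - (cosh R / g b)) (at t within I)" for I
    by (rule DERIV_chain'[OF dbt, unfolded beta_at]) (rule R_of_has_deriv[OF g_cont b4])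
  have dp: "((\<lambda>t. phi_of g (beta_at t)) has_real_derivative (cos b * g b) * - (cosh R / g b)) (at t within I)" for I
    by (rule DERIV_chain'[OF dbt, unfolded beta_at]) (rule phi_of_has_deriv[OF g_cont b4])
  have "g b * (2 * (sin b * tan (2 * p)) + 3 * (cos b * tanh R + 1 / cosh R)) = 1"
    using g_eq[OF b] by (simp add: rate_of_def rate_def R_def p_def)
  then have k: "2 * (sin b * tan (2 * p)) + 3 * (cos b * tanh R + 1 / cosh R) = 1 / g b"
    using g0 by (simp only: eq_divide_eq mult.commute[of _ "g b"]) simp
  let ?I = "{0..3991/10000}"
  have "(r has_real_derivative cos (\<alpha> t)) (at t within ?I)"
    unfolding r_def[abs_def]
    by (rule derivative_eq_intros dR refl | simp)+ (use g0 ch in \<open>simp add: beta_at al sq flip: R_def\<close>,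
        use g0 ch in \<open>simp add: field_simps power2_eq_square\<close>)
  moreover have "(\<theta> has_real_derivative sin (\<alpha> t) / sin (r t)) (at t within ?I)"
    unfolding \<theta>_def[abs_def] sin_r al
    by (rule derivative_eq_intros dp refl | simp)+ (use g0 ch in \<open>simp add: field_simps\<close>)
  moreover have "(\<alpha> has_real_derivative
           2 * cot (2 * \<theta> t) / sin (r t) * cos (\<alpha> t) - 3 * cot (r t) * sin (\<alpha> t) - 3)
          (at t within ?I)"
  proof -
    have cot_r: "cot (r t) = sinh R" using ch by (simp add: cot_def sin_r cos_r)
    have "2 * cot (2 * \<theta> t) / sin (r t) * cos (\<alpha> t) - 3 * cot (r t) * sin (\<alpha> t) - 3
      = - cosh R * (2 * (sin b * tan (2 * p)) + 3 * (cos b * tanh R + 1 / cosh R))"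
      unfolding cot_th sin_r al cot_r using ch by (simp add: tanh_def field_simps)
    also have "\<dots> = - (cosh R / g b)" unfolding k by simp
    finally show ?thesis
      unfolding \<alpha>_def[abs_def] using DERIV_add[OF dbt DERIV_const[of "pi / 2"]] by simp
  qed
  ultimately show "sin (r t) \<noteq> 0 \<and> sin (2 * \<theta> t) \<noteq> 0 \<and>
        (r has_real_derivative cos (\<alpha> t)) (at t within ?I) \<and>
        (\<theta> has_real_derivative sin (\<alpha> t) / sin (r t)) (at t within ?I) \<and>
        (\<alpha> has_real_derivative
           2 * cot (2 * \<theta> t) / sin (r t) * cos (\<alpha> t) - 3 * cot (r t) * sin (\<alpha> t) - 3)
          (at t within ?I)"
    using cp ch by (simp add: sin_r cot_th)
qed

end

theorem theorem1p1:
  shows "\<exists>a t\<^sub>0 :: real. a \<in> {5204/10000<..<5244/10000} \<and> t\<^sub>0 \<in> {3966/10000<..<3991/10000} \<and>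
    (\<exists>r \<theta> \<alpha> :: real \<Rightarrow> real.
       solves_system r \<theta> \<alpha> {0..3991/10000} \<and>
       r 0 = pi / 2 \<and> \<theta> 0 = a \<and> \<alpha> 0 = pi \<and>
       \<alpha> t\<^sub>0 = pi / 2 \<and> \<theta> t\<^sub>0 = pi / 4)"
proof -
  obtain g where "near_app g" "\<And>b. g b = picard g b" using fixpoint_exists by auto
  then interpret fixed_profile g by unfold_locales
  have beta_at_0: "beta_at 0 = pi / 2" using beta_at_time[of "pi / 2"] pi_half_less_4 pi_gt_zero by (simp add: time_pi_half)
  have beta_at_time_0: "beta_at (time 0) = 0" by (rule beta_at_time) auto
  have "r 0 = pi / 2" "\<theta> 0 = pi / 4 - phi_of g (pi / 2)" "\<alpha> 0 = pi"
    "\<alpha> (time 0) = pi / 2" "\<theta> (time 0) = pi / 4"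
    unfolding r_def \<theta>_def \<alpha>_def beta_at_0 beta_at_time_0 by simp_all
  moreover have "time 0 \<in> {3966/10000<..<3991/10000}" using time_0 by simp
  ultimately show ?thesis using solution initial_theta by blast
qed

end
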